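(* Let $H=H(m,n;\underline{t})$ be the Hamiltonian superalgebra over an algebraically closed field $\mathbb{F}$ of characteristic $p>2$. Then every skew-symmetric super-biderivation of $H$ is inner: for every skew-symmetric super-biderivation $\phi$ of $H$ there exists $\lambda\in\mathbb{F}$ such that $\phi(x,y)=\lambda[x,y]$ for all $x,y\in H$. Equivalently, $\mathrm{BDer}(H)=\mathrm{IBDer}(H)$.
   Context: Setting for $H$: $\mathbb{F}$ is algebraically closed of characteristic $p>2$; $m=2k$ and $n=2t$ are even integers with $m,n\ge 2$; $s=m+n$; $Y_0=\{1,\dots,m\}$, $Y_1=\{m+1,\dots,s\}$, $Y=Y_0\cup Y_1$. Fix positive integers $\underline{t}=(t_1,\dots,t_m)$ and put $\pi_i=p^{t_i}-1$. Let $\Lambda(m,n;\underline{t})$ be the associative superalgebra with $\mathbb{F}$-basis $x^{(\alpha)}x^u$, where $\alpha\in\mathbb{N}^m$ with $0\le\alpha_i\le\pi_i$, and $u=\langle i_1,\dots,i_r\rangle$ with $m+1\le i_1<\dots<i_r\le s$ ($x^u=x_{i_1}\cdots x_{i_r}$, $x^{\varnothing}=1$); multiplication is given by $x^{(\alpha)}x^{(\beta)}=\binom{\alpha+\beta}{\alpha}x^{(\alpha+\beta)}$ (with $\binom{\alpha+\beta}{\alpha}=\prod_i\binom{\alpha_i+\beta_i}{\alpha_i}$), $x_ix_j=-x_jx_i$ for $i,j\in Y_1$, and $x^{(\alpha)}x_j=x_jx^{(\alpha)}$; the parity of $x^{(\alpha)}x^u$ is $|u| \bmod 2$. Write $x_i=x^{(\varepsilon_i)}$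 for $i\in Y_0$, where $\varepsilon_i$ is the $i$-th unit vector. Define linear maps $D_i$ on $\Lambda(m,n;\underline{t})$ by $D_i(x^{(\alpha)}x^u)=x^{(\alpha-\varepsilon_i)}x^u$ (zero if $\alpha_i=0$) for $i\in Y_0$ and $D_i(x^{(\alpha)}x^u)=x^{(\alpha)}\partial_i(x^u)$ for $i\in Y_1$, where $\partial_i$ is the standard (odd) partial derivative of the Grassmann algebra; $D_i$ has parity $\tau(i)=\bar 0$ for $i\in Y_0$ and $\tau(i)=\bar 1$ for $i\in Y_1$. The generalized Witt superalgebra $W(m,n;\underline t)=\{\sum_{i\in Y}f_iD_i: f_i\in\Lambda(m,n;\underline t)\}$ has bracket $[fD_i,gD_j]=fD_i(g)D_j-(-1)^{\mathrm{d}(fD_i)\mathrm{d}(gD_j)}gD_j(f)D_i$. Define $i'=i+k$ for $1\le i\le k$, $i'=i-k$ for $k<i\le 2k$, $i'=i+t$ for $2k<i\le 2k+t$, $i'=i-t$ for $2k+t<i\le s$; $\sigma(i)=1$ for $1\le i\le k$, $\sigma(i)=-1$ for $k<i\le 2k$, $\sigma(i)=1$ for $2k<i\le s$. For $\mathbb{Z}_2$-homogeneous $f$ set $D_H(f)=\sum_{i\in Y}\sigma(i')(-1)^{\tau(i')\mathrm{d}(f)}D_{i'}(f)D_i$, extended linearly. Let $\overline{H}=\mathrm{span}\{D_H(f): f\in\Lambda(m,n;\underline t)\}$ and $H=H(m,n;\underline t)=[\overline{H},\overline{H}]$ (a finite-dimensional simple Lie superalgebra). Super-biderivations: for a Lie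 superalgebra $L=L_{\bar0}\oplus L_{\bar1}$, a bilinear map $\phi:L\times L\to L$ is $\mathbb{Z}_2$-homogeneous of degree $\mathrm{d}(\phi)$ if $\phi(L_\alpha,L_\beta)\subseteq L_{\alpha+\beta+\mathrm{d}(\phi)}$. A skew-symmetric super-biderivation of $L$ is a $\mathbb{Z}_2$-homogeneous bilinear map $\phi$ with $\phi(x,[y,z])=[\phi(x,y),z]+(-1)^{(\mathrm{d}(\phi)+\mathrm{d}(x))\mathrm{d}(y)}[y,\phi(x,z)]$ and $\phi(x,y)=-(-1)^{\mathrm{d}(\phi)\mathrm{d}(x)+\mathrm{d}(\phi)\mathrm{d}(y)+\mathrm{d}(x)\mathrm{d}(y)}\phi(y,x)$ for all homogeneous $x,y,z$. $\mathrm{BDer}_{\bar0}(L)$, $\mathrm{BDer}_{\bar1}(L)$ denote those of degree $\bar0$, $\bar1$, and $\mathrm{BDer}(L)=\mathrm{BDer}_{\bar0}(L)\oplus\mathrm{BDer}_{\bar1}(L)$. $\mathrm{IBDer}(L)$ is the set of maps $\phi_\lambda(x,y)=\lambda[x,y]$, $\lambda\in\mathbb{F}$ (inner super-biderivations). *)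

theory Defs
  imports "HOL-Computational_Algebra.Polynomial"
begin

(* Monomials x^(alpha) x^u of Lambda(m,n;t): alpha :: nat => nat (indices 1..m),
   u :: nat set (a subset of {m+1..m+n}, read as the increasing product). *)
type_synonym mon = "(nat \<Rightarrow> nat) \<times> nat set"
(* elements of Lambda: coefficient functions on monomials *)
type_synonym 'a lam = "mon \<Rightarrow> 'a"
(* elements of W: sum_i f_i D_i, represented as i |-> f_i *)
type_synonym 'a wel = "nat \<Rightarrow> mon \<Rightarrow> 'a"

definition Y0 :: "nat \<Rightarrow> nat set" where "Y0 m = {1..m}"
definition Y1 :: "nat \<Rightarrow> nat \<Rightarrow> nat set" where "Y1 m n = {m+1..m+n}"
definition YY :: "nat \<Rightarrow> nat \<Rightarrow> nat set" where "YY m n = {1..m+n}"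

(* tau(i): parity of D_i *)
definition tau :: "nat \<Rightarrow> nat \<Rightarrow> nat" where "tau m i = (if i \<in> Y0 m then 0 else 1)"

definition LB :: "nat \<Rightarrow> nat \<Rightarrow> nat \<Rightarrow> (nat \<Rightarrow> nat) \<Rightarrow> mon set" where
  "LB p m n tt = {(\<alpha>, u). (\<forall>i\<in>Y0 m. \<alpha> i \<le> p ^ tt i - 1) \<and> (\<forall>i. i \<notin> Y0 m \<longrightarrow> \<alpha> i = 0)
                      \<and> u \<subseteq> Y1 m n}"

definition inLam :: "nat \<Rightarrow> nat \<Rightarrow> nat \<Rightarrow> (nat \<Rightarrow> nat) \<Rightarrow> ('a::zero) lam \<Rightarrow> bool" where
  "inLam p m n tt f \<longleftrightarrow> (\<forall>b. b \<notin> LB p m n tt \<longrightarrow> f b = 0)"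

definition proj :: "nat \<Rightarrow> ('a::zero) lam \<Rightarrow> 'a lam" where
  "proj d f = (\<lambda>b. if card (snd b) mod 2 = d then f b else 0)"

(* sign of x^u x^v = sgn * x^(u Un v) for disjoint u, v *)
definition sgnmon :: "nat set \<Rightarrow> nat set \<Rightarrow> 'a::comm_ring_1" where
  "sgnmon u v = (-1) ^ card {(i, j). i \<in> u \<and> j \<in> v \<and> j < i}"

(* coefficient of x^(alpha) x^u * x^(beta) x^v *)
definition mcoef :: "nat \<Rightarrow> mon \<Rightarrow> mon \<Rightarrow> 'a::comm_ring_1" where
  "mcoef m b c = (if snd b \<inter> snd c = {}
      then of_nat (\<Prod>i\<in>Y0 m. (fst b i + fst c i) choose (fst b i)) * sgnmon (snd b) (snd c)
      else 0)"

definition lmul :: "nat \<Rightarrow> nat \<Rightarrow> nat \<Rightarrow> (nat \<Rightarrow> nat) \<Rightarrow> 'a::comm_ring_1 lam \<Rightarrow> 'a lam \<Rightarrow> 'a lam" where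
  "lmul p m n tt f g = (\<lambda>z. if z \<in> LB p m n tt then
      (\<Sum>b\<in>LB p m n tt. \<Sum>c\<in>LB p m n tt.
          (if (\<lambda>i. fst b i + fst c i) = fst z \<and> snd b \<union> snd c = snd z
           then f b * g c * mcoef m b c else 0))
      else 0)"

definition Dop :: "nat \<Rightarrow> nat \<Rightarrow> nat \<Rightarrow> (nat \<Rightarrow> nat) \<Rightarrow> nat \<Rightarrow> 'a::comm_ring_1 lam \<Rightarrow> 'a lam" where
  "Dop p m n tt i f = (\<lambda>(\<alpha>, u).
     if (\<alpha>, u) \<in> LB p m n tt then
       (if i \<in> Y0 m then
          (if (\<alpha>(i := \<alpha> i + 1), u) \<in> LB p m n tt then f (\<alpha>(i := \<alpha> i + 1), u) else 0)
        else if i \<in> Y1 m n \<and> i \<notin> u then (-1) ^ card {j \<in> u. j < i} * f (\<alpha>, insert i u)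
        else 0)
     else 0)"

(* bracket of W(m,n;t), bilinear extension of the bracket on homogeneous f D_i, g D_j *)
definition brW :: "nat \<Rightarrow> nat \<Rightarrow> nat \<Rightarrow> (nat \<Rightarrow> nat) \<Rightarrow> 'a::comm_ring_1 wel \<Rightarrow> 'a wel \<Rightarrow> 'a wel" where
  "brW p m n tt X Y = (\<lambda>k z.
     \<Sum>i\<in>YY m n. \<Sum>j\<in>YY m n. \<Sum>a\<in>{0,1}. \<Sum>b\<in>{0,1}.
       (if k = j then lmul p m n tt (proj a (X i)) (Dop p m n tt i (proj b (Y j))) z else 0)
       - (-1) ^ ((a + tau m i) * (b + tau m j)) *
         (if k = i then lmul p m n tt (proj b (Y j)) (Dop p m n tt j (proj a (X i))) z else 0))"

definition addW :: "'a::plus wel \<Rightarrow> 'a wel \<Rightarrow> 'a wel" where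
  "addW X Y = (\<lambda>k z. X k z + Y k z)"

definition scaleW :: "'a::times \<Rightarrow> 'a wel \<Rightarrow> 'a wel" where
  "scaleW c X = (\<lambda>k z. c * X k z)"

definition homW :: "nat \<Rightarrow> nat \<Rightarrow> ('a::zero) wel \<Rightarrow> bool" where
  "homW m d X \<longleftrightarrow> (\<forall>i b. X i b \<noteq> 0 \<longrightarrow> (card (snd b) + tau m i) mod 2 = d)"

definition iprime :: "nat \<Rightarrow> nat \<Rightarrow> nat \<Rightarrow> nat" where
  "iprime m n i = (let k = m div 2; t = n div 2 in
      if i \<le> k then i + k else if i \<le> 2*k then i - k
      else if i \<le> 2*k + t then i + t else i - t)"

definition sigma :: "nat \<Rightarrow> nat \<Rightarrow> 'a::comm_ring_1" where
  "sigma m i = (if m div 2 < i \<and> i \<le> m then -1 else 1)"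

(* D_H on homogeneous f of parity d, and its linear extension *)
definition DHh :: "nat \<Rightarrow> nat \<Rightarrow> nat \<Rightarrow> (nat \<Rightarrow> nat) \<Rightarrow> nat \<Rightarrow> 'a::comm_ring_1 lam \<Rightarrow> 'a wel" where
  "DHh p m n tt d f = (\<lambda>i z. if i \<in> YY m n then
      sigma m (iprime m n i) * (-1) ^ (tau m (iprime m n i) * d) * Dop p m n tt (iprime m n i) f z
      else 0)"

definition DH :: "nat \<Rightarrow> nat \<Rightarrow> nat \<Rightarrow> (nat \<Rightarrow> nat) \<Rightarrow> 'a::comm_ring_1 lam \<Rightarrow> 'a wel" where
  "DH p m n tt f = addW (DHh p m n tt 0 (proj 0 f)) (DHh p m n tt 1 (proj 1 f))"

(* H = [Hbar, Hbar]: the span of all brackets [D_H(f), D_H(g)] *)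
definition Hset :: "nat \<Rightarrow> nat \<Rightarrow> nat \<Rightarrow> (nat \<Rightarrow> nat) \<Rightarrow> 'a::comm_ring_1 wel set" where
  "Hset p m n tt = {(\<lambda>k z. \<Sum>l<N. brW p m n tt (DH p m n tt (f l)) (DH p m n tt (g l)) k z) | N
      (f :: nat \<Rightarrow> 'a lam) (g :: nat \<Rightarrow> 'a lam).
      \<forall>l<N. inLam p m n tt (f l) \<and> inLam p m n tt (g l)}"

definition skew_super_biderivation ::
  "'a::comm_ring_1 wel set \<Rightarrow> ('a wel \<Rightarrow> 'a wel \<Rightarrow> 'a wel) \<Rightarrow> (nat \<Rightarrow> 'a wel \<Rightarrow> bool)
     \<Rightarrow> nat \<Rightarrow> ('a wel \<Rightarrow> 'a wel \<Rightarrow> 'a wel) \<Rightarrow> bool" where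
  "skew_super_biderivation L br hom dphi phi \<longleftrightarrow>
     dphi < 2 \<and>
     (\<forall>x\<in>L. \<forall>y\<in>L. phi x y \<in> L) \<and>
     (\<forall>x\<in>L. \<forall>y\<in>L. \<forall>z\<in>L. \<forall>c.
        phi (addW x y) z = addW (phi x z) (phi y z) \<and>
        phi z (addW x y) = addW (phi z x) (phi z y) \<and>
        phi (scaleW c x) z = scaleW c (phi x z) \<and>
        phi z (scaleW c x) = scaleW c (phi z x)) \<and>
     (\<forall>a b x y. a < 2 \<longrightarrow> b < 2 \<longrightarrow> x \<in> L \<longrightarrow> y \<in> L \<longrightarrow> hom a x \<longrightarrow> hom b y \<longrightarrow>
        hom ((a + b + dphi) mod 2) (phi x y)) \<and>
     (\<forall>a b c x y z. a < 2 \<longrightarrow> b < 2 \<longrightarrow> c < 2 \<longrightarrow> x \<in> L \<longrightarrow> y \<in> L \<longrightarrow> z \<in> L \<longrightarrow>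
        hom a x \<longrightarrow> hom b y \<longrightarrow> hom c z \<longrightarrow>
        phi x (br y z) = addW (br (phi x y) z) (scaleW ((-1) ^ ((dphi + a) * b)) (br y (phi x z)))) \<and>
     (\<forall>a b x y. a < 2 \<longrightarrow> b < 2 \<longrightarrow> x \<in> L \<longrightarrow> y \<in> L \<longrightarrow> hom a x \<longrightarrow> hom b y \<longrightarrow>
        phi x y = scaleW (- ((-1) ^ (dphi * a + dphi * b + a * b))) (phi y x))"

end

theory Submission
  imports Defs "HOL-Library.Function_Algebras"
begin

text \<open>
  Brackets with the partial derivatives \<open>D_l\<close> act on \<open>H\<close> as differentiation of the Hamiltonian
  function, and an element commuting with the \<open>D_H(x_S)\<close> for \<open>|S| \<le> 2\<close> (with \<open>x_S\<close> a multilinear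
  monomial) vanishes.

  Expanding \<open>phi([x,u],[y,v])\<close> in two ways shows that the defect of
  \<open>[phi(x,y),[u,v]] = [[x,y],phi(u,v)]\<close> is, up to Koszul signs, skew under exchanging \<open>x,y\<close> and
  symmetric under exchanging \<open>x,u\<close>. All transpositions are conjugate, so the defect is its own
  negative and vanishes, \<open>p\<close> being odd.

  Hence \<open>phi(D_i,D_j)\<close> centralizes all brackets and is zero, so \<open>phi(D_i,-)\<close> commutes with the \<open>D_l\<close>
  up to sign. Then \<open>phi(D_j, D_H(x_j x_q))\<close> is a constant-coefficient field, and since \<open>m + n \<ge> 4\<close>
  the identity above, applied to cubic monomials, forces it to be a multiple of
  \<open>[D_j, D_H(x_j x_q)]\<close>. The factor does not depend on \<open>j\<close> and \<open>q\<close> and is zero if \<open>phi\<close> is odd; call it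
  \<open>c\<close>. By the identity once more, \<open>phi(x,y) - c [x,y]\<close> centralizes enough elements to be zero.
\<close>

section \<open>The divided power superalgebra\<close>

text \<open>No basis of \<open>H\<close> is ever determined. All elements used come from
  \<open>D_H(D_l g) = [D_l, D_H(g)]\<close>, which lies in \<open>H\<close> for every
  \<open>g\<close>; in particular \<open>x_S\<close> is, up to sign, a derivative of
  \<open>x_S x_l\<close> for any index \<open>l\<close> outside \<open>S\<close>. The smallest case
  \<open>m = n = 2\<close> offers only four indices. This is why \<open>phi\<close> is tested on
  multilinear monomials of degree at most three: one index always remains free to be differentiated
  away.

  The defect argument concerns the group of permutations of the first three entries
  \<open>x\<close>, \<open>y\<close>, \<open>u\<close>, with \<open>v\<close> fixed. After removal
  of Koszul signs, one transposition would act by -1 and another by +1, whereas conjugate elements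
  must act by the same scalar.

  Two features of divided powers matter. Cutting the algebra off at exponent
  \<open>p ^ tt i - 1\<close> is compatible with the Leibniz rule because \<open>p\<close> divides
  the inner binomial coefficients of \<open>p ^ tt i\<close>. Moreover \<open>D_i\<close> lowers an
  exponent with coefficient 1, so only constants are killed by all \<open>D_i\<close>, although the
  characteristic is positive.\<close>

definition sc :: "'a::times \<Rightarrow> ('b \<Rightarrow> 'a) \<Rightarrow> 'b \<Rightarrow> 'a" where
  "sc c f = (\<lambda>z. c * f z)"

lemma sc_apply [simp]: "sc c f z = c * f z"
  by (simp add: sc_def)

lemma sc_simps [simp]:
  fixes f g :: "'b \<Rightarrow> 'a::comm_ring_1"
  shows "sc c (f + g) = sc c f + sc c g" "sc c (f - g) = sc c f - sc c g" "sc c (- f) = - sc c f"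
    "sc c 0 = 0" "sc 0 f = 0" "sc 1 f = f" "sc c (sc d f) = sc (c * d) f" "sc (- c) f = - sc c f"
  by (auto simp: fun_eq_iff algebra_simps)

lemma sc_add_left: "sc (c + d) f = sc c f + sc d (f :: 'b \<Rightarrow> 'a::comm_ring_1)"
  by (auto simp: fun_eq_iff algebra_simps)

lemma sum_apply: "(\<Sum>i\<in>I. f i) z = (\<Sum>i\<in>I. f i z :: 'a::comm_monoid_add)"
  by (induction I rule: infinite_finite_induct) auto

lemma sc_sum: "sc c (\<Sum>i\<in>I. f i) = (\<Sum>i\<in>I. sc (c::'a::comm_ring_1) (f i))"
  by (auto simp: fun_eq_iff sum_apply sum_distrib_left)

definition lin :: "(('b \<Rightarrow> 'a::comm_ring_1) \<Rightarrow> 'c \<Rightarrow> 'a) \<Rightarrow> bool" where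
  "lin F \<longleftrightarrow> (\<forall>f g. F (f + g) = F f + F g) \<and> (\<forall>c f. F (sc c f) = sc c (F f))"

lemma
  assumes "lin F"
  shows lin_add: "F (f + g) = F f + F g"
    and lin_sc: "F (sc c f) = sc c (F f)"
    and lin_zero: "F 0 = 0"
    and lin_minus: "F (- f) = - F f"
    and lin_diff: "F (f - g) = F f - F g"
proof -
  show a: "F (f + g) = F f + F g" for f g using assms by (simp add: lin_def)
  show s: "F (sc c f) = sc c (F f)" for f c using assms by (simp add: lin_def)
  show z: "F 0 = 0" using s[of 0 0] by simp
  show u: "F (- f) = - F f" for f using s[of "-1" f] by simp
  show "F (f - g) = F f - F g" using a[of f "- g"] u[of g] by simp
qed

lemma lin_sum: "lin F \<Longrightarrow> F (\<Sum>i\<in>I. f i) = (\<Sum>i\<in>I. F (f i))"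
  by (induction I rule: infinite_finite_induct) (auto simp: lin_add lin_zero)

definition mono1 :: "mon \<Rightarrow> 'a::zero_neq_one lam" where
  "mono1 b = (\<lambda>z. if z = b then 1 else 0)"

definition madd :: "mon \<Rightarrow> mon \<Rightarrow> mon" where
  "madd b c = (\<lambda>i. fst b i + fst c i, snd b \<union> snd c)"

lemma madd_simps [simp]:
  "fst (madd b c) i = fst b i + fst c i" "snd (madd b c) = snd b \<union> snd c"
  by (auto simp: madd_def)

lemma madd_assoc: "madd (madd b c) d = madd b (madd c d)"
  by (auto simp: madd_def add.assoc)

lemma madd_comm: "madd b c = madd c b"
  by (auto simp: madd_def add.commute)

text \<open>The number of inversions of the word \<open>x^u x^v\<close>, that is, the exponent in
  \<open>sgnmon\<close>. Keeping it as a natural number turns sign identities into parity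
  statements.\<close>

definition ninv :: "nat set \<Rightarrow> nat set \<Rightarrow> nat" where
  "ninv u v = card {(i, j). i \<in> u \<and> j \<in> v \<and> j < i}"

lemma fin_inv: "finite u \<Longrightarrow> finite v \<Longrightarrow> finite {(i::nat, j). i \<in> u \<and> j \<in> v \<and> j < i}"
  by (rule finite_subset[of _ "u \<times> v"]) auto

lemma ninv_Un_left:
  assumes "finite u" "finite v" "finite w" "u \<inter> v = {}"
  shows "ninv (u \<union> v) w = ninv u w + ninv v w"
proof -
  have "{(i, j). i \<in> u \<union> v \<and> j \<in> w \<and> j < i} =
     {(i, j). i \<in> u \<and> j \<in> w \<and> j < i} \<union> {(i, j). i \<in> v \<and> j \<in> w \<and> j < i}" by auto
  then show ?thesis using assms unfolding ninv_def
    by (simp only:) (rule card_Un_disjoint, auto intro: fin_inv)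
qed

lemma ninv_Un_right:
  assumes "finite u" "finite v" "finite w" "v \<inter> w = {}"
  shows "ninv u (v \<union> w) = ninv u v + ninv u w"
proof -
  have "{(i, j). i \<in> u \<and> j \<in> v \<union> w \<and> j < i} =
     {(i, j). i \<in> u \<and> j \<in> v \<and> j < i} \<union> {(i, j). i \<in> u \<and> j \<in> w \<and> j < i}" by auto
  then show ?thesis using assms unfolding ninv_def
    by (simp only:) (rule card_Un_disjoint, auto intro: fin_inv)
qed

text \<open>Each pair in \<open>u \<times> v\<close> is out of order in exactly one of the two
  words. This is the source of supercommutativity.\<close>

lemma ninv_swap:
  assumes "finite u" "finite v" "u \<inter> v = {}"
  shows "ninv u v + ninv v u = card u * card v"
proof -
  have "u \<times> v = {(i, j). i \<in> u \<and> j \<in> v \<and> j < i} \<union> prod.swap ` {(i, j). i \<in> v \<and> j \<in> u \<and> j < i}"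
    using assms(3) by (fastforce simp: image_iff)
  then have "card (u \<times> v) = card {(i, j). i \<in> u \<and> j \<in> v \<and> j < i}
      + card (prod.swap ` {(i, j). i \<in> v \<and> j \<in> u \<and> j < i})"
    using assms by (simp only:) (rule card_Un_disjoint, auto intro: fin_inv)
  moreover have "card (prod.swap ` {(i, j). i \<in> v \<and> j \<in> u \<and> j < i}) = ninv v u"
    unfolding ninv_def by (rule card_image) (auto simp: inj_on_def)
  ultimately show ?thesis by (simp add: ninv_def card_cartesian_product)
qed

lemma ninv_singleton_left: "ninv {i} v = card {j \<in> v. j < i}"
proof -
  have "{(a, j). a \<in> {i} \<and> j \<in> v \<and> j < a} = Pair i ` {j \<in> v. j < i}" by auto
  then show ?thesis by (simp add: ninv_def card_image inj_on_def)
qed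

lemma sgnmon_ninv: "sgnmon u v = (-1) ^ ninv u v"
  by (simp add: sgnmon_def ninv_def)

text \<open>Both sides are the trinomial coefficient of \<open>a\<close>, \<open>b\<close>,
  \<open>c\<close>.\<close>

lemma choose_assoc:
  "((a + b) choose a) * ((a + b + c) choose (a + b)) = ((b + c) choose b) * ((a + b + c) choose a)"
proof -
  have "((a + b + c) choose (a + b)) * ((a + b) choose a) = ((a + b + c) choose a) * ((a + b + c - a) choose (a + b - a))"
    by (rule choose_mult) auto
  then show ?thesis by (simp add: mult.commute add.assoc)
qed

text \<open>In \<open>a * (p^t choose a) = p^t * (p^t - 1 choose a - 1)\<close>, a binomial
  coefficient prime to \<open>p\<close> would force \<open>p^t\<close> to divide the smaller number
  \<open>a\<close>.\<close>

lemma prime_dvd_choose_prime_power: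
  fixes p :: nat
  assumes "prime p" "0 < a" "a < p ^ t"
  shows "p dvd (p ^ t choose a)"
proof (rule ccontr)
  assume "\<not> p dvd (p ^ t choose a)"
  then have "coprime (p ^ t) (p ^ t choose a)"
    using assms(1) by (simp add: prime_imp_coprime)
  moreover have "a * (p ^ t choose a) = p ^ t * ((p ^ t - 1) choose (a - 1))"
    using assms by (metis Suc_diff_1 binomial_absorption less_nat_zero_code not_gr_zero)
  ultimately have "p ^ t dvd a"
    by (metis coprime_dvd_mult_left_iff dvd_triv_left)
  then show False using assms(2,3) by (auto dest: dvd_imp_le)
qed

lemma minus_one_power_eqI:
  "even (a + b) \<Longrightarrow> (-1::'a::ring_1) ^ a = (-1) ^ b"
  by (auto simp: minus_one_power_iff)

locale hamiltonian =
  fixes p m n :: nat and tt :: "nat \<Rightarrow> nat" and ty :: "'a::field itself"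
  assumes prime_p: "prime p" and char_p: "CHAR('a) = p" and p_gt_2: "p > 2"
    and even_m: "even m" and even_n: "even n" and m_ge: "m \<ge> 2" and n_ge: "n \<ge> 2"
    and tt_pos: "\<And>i. i \<in> {1..m} \<Longrightarrow> tt i > 0"
begin

abbreviation "B \<equiv> LB p m n tt"
abbreviation mul :: "'a lam \<Rightarrow> 'a lam \<Rightarrow> 'a lam"  (infixl "\<cdot>" 70) where "f \<cdot> g \<equiv> lmul p m n tt f g"
abbreviation D :: "nat \<Rightarrow> 'a lam \<Rightarrow> 'a lam" where "D i f \<equiv> Dop p m n tt i f"
abbreviation xm :: "mon \<Rightarrow> 'a lam" where "xm b \<equiv> mono1 b"

section \<open>The finite monomial basis and reduction of linear identities to it\<close>

lemma finite_B: "finite B"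
proof -
  let ?A = "{\<alpha>. \<forall>i. (i \<in> {1..m} \<longrightarrow> \<alpha> i \<in> {..Max ((\<lambda>i. p ^ tt i - 1) ` {1..m})}) \<and> (i \<notin> {1..m} \<longrightarrow> \<alpha> i = (0::nat))}"
  have "B \<subseteq> ?A \<times> Pow {m+1..m+n}"
    by (auto simp: LB_def Y0_def Y1_def m_ge intro!: Max_ge_iff[THEN iffD2])
      (metis atLeastAtMost_iff rev_image_eqI)+
  moreover have "finite ?A" by (rule finite_set_of_finite_funs) auto
  ultimately show ?thesis by (meson finite_Pow_iff finite_SigmaI finite_atLeastAtMost finite_subset)
qed

lemma fin_snd: "b \<in> B \<Longrightarrow> finite (snd b)"
  by (cases b) (simp add: LB_def Y1_def, meson finite_atLeastAtMost finite_subset)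

lemma madd_B_left: "madd b c \<in> B \<Longrightarrow> b \<in> B"
  by (fastforce simp: LB_def madd_def split: prod.splits)

text \<open>Linear maps that only see the coefficients in \<open>B\<close> agree everywhere as soon as they agree on
  monomials, since the operations on \<open>Lambda\<close> discard all other coefficients.\<close>

definition llin :: "('a lam \<Rightarrow> 'b \<Rightarrow> 'a) \<Rightarrow> bool" where
  "llin F \<longleftrightarrow> lin F \<and> (\<forall>f g. (\<forall>b\<in>B. f b = g b) \<longrightarrow> F f = F g)"

lemma llin_lin: "llin F \<Longrightarrow> lin F" by (simp add: llin_def)

lemma llin_expand:
  assumes "llin F"
  shows "F f = (\<Sum>b\<in>B. sc (f b) (F (xm b)))"
proof -
  have "F f = F (\<Sum>b\<in>B. sc (f b) (xm b))"
  proof -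
    have "\<forall>z\<in>B. f z = (\<Sum>b\<in>B. sc (f b) (xm b)) z"
      by (simp add: sum_apply mono1_def finite_B if_distrib[of "(*) _"] cong: if_cong)
    then show ?thesis using assms unfolding llin_def by blast
  qed
  then show ?thesis by (simp only: lin_sum[OF llin_lin[OF assms]] lin_sc[OF llin_lin[OF assms]])
qed

text \<open>The premise is restricted to monomials in the support of \<open>f\<close>, so that a
  parity assumption on \<open>f\<close> is inherited by every monomial that has to be
  checked.\<close>

lemma llin_eqI:
  assumes "llin F" "llin G" "\<And>b. b \<in> B \<Longrightarrow> f b \<noteq> 0 \<Longrightarrow> F (xm b) = G (xm b)"
  shows "F f = G f"
  unfolding llin_expand[OF assms(1), of f] llin_expand[OF assms(2), of f]
  by (rule sum.cong) (use assms(3) in \<open>auto\<close>, metis sc_simps(5))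

lemma llin_local: "llin F \<Longrightarrow> (\<And>b. b \<in> B \<Longrightarrow> f b = g b) \<Longrightarrow> F f = F g"
  by (simp add: llin_def)

lemma llinI:
  assumes "\<And>f g. F (f + g) = F f + F g" "\<And>c f. F (sc c f) = sc c (F f)"
    "\<And>f g. (\<And>b. b \<in> B \<Longrightarrow> f b = g b) \<Longrightarrow> F f = F g"
  shows "llin F"
  using assms unfolding llin_def lin_def by blast

lemma llin_comp:
  assumes "lin F" "llin G"
  shows "llin (\<lambda>f. F (G f))"
proof (rule llinI)
  note l = lin_add[OF assms(1)] lin_sc[OF assms(1)]
    lin_add[OF llin_lin[OF assms(2)]] lin_sc[OF llin_lin[OF assms(2)]]
  show "F (G (f + g)) = F (G f) + F (G g)" for f g by (simp only: l)
  show "F (G (sc c f)) = sc c (F (G f))" for f c by (simp only: l)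
  show "F (G f) = F (G g)" if "\<And>b. b \<in> B \<Longrightarrow> f b = g b" for f g
    using llin_local[OF assms(2) that] by simp
qed

lemma llin_add:
  assumes "llin F" "llin G"
  shows "llin (\<lambda>f. F f + G f)"
proof (rule llinI)
  note l = lin_add[OF llin_lin[OF assms(1)]] lin_sc[OF llin_lin[OF assms(1)]]
    lin_add[OF llin_lin[OF assms(2)]] lin_sc[OF llin_lin[OF assms(2)]]
  show "F (f + g) + G (f + g) = F f + G f + (F g + G g)" for f g by (simp only: l add_ac)
  show "F (sc c f) + G (sc c f) = sc c (F f + G f)" for f c by (simp only: l sc_simps)
  show "F f + G f = F g + G g" if "\<And>b. b \<in> B \<Longrightarrow> f b = g b" for f g
    using llin_local[OF assms(1) that] llin_local[OF assms(2) that] by simp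
qed

lemma lin_sc_map: "lin (sc c)"
  unfolding lin_def by (auto simp: mult.commute)

lemma llin_sc: "llin F \<Longrightarrow> llin (\<lambda>f. sc c (F f))"
  by (rule llin_comp[OF lin_sc_map])

lemma llin_mul_left: "llin (\<lambda>f. f \<cdot> g)"
proof (rule llinI)
  show "(f + f') \<cdot> g = f \<cdot> g + f' \<cdot> g" for f f'
    by (rule ext) (auto simp: lmul_def sum.distrib[symmetric] distrib_right intro!: sum.cong)
  show "sc c f \<cdot> g = sc c (f \<cdot> g)" for c f
    by (rule ext) (auto simp: lmul_def sum_distrib_left mult.assoc intro!: sum.cong)
  show "f \<cdot> g = f' \<cdot> g" if "\<And>b. b \<in> B \<Longrightarrow> f b = f' b" for f f'
    by (rule ext) (auto simp: lmul_def that intro!: sum.cong)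
qed

lemma llin_mul_right: "llin (\<lambda>g. f \<cdot> g)"
proof (rule llinI)
  show "f \<cdot> (g + g') = f \<cdot> g + f \<cdot> g'" for g g'
    by (rule ext) (auto simp: lmul_def sum.distrib[symmetric] distrib_left distrib_right intro!: sum.cong)
  show "f \<cdot> sc c g = sc c (f \<cdot> g)" for c g
    by (rule ext) (auto simp: lmul_def sum_distrib_left mult.assoc mult.left_commute intro!: sum.cong)
  show "f \<cdot> g = f \<cdot> g'" if "\<And>b. b \<in> B \<Longrightarrow> g b = g' b" for g g'
    by (rule ext) (auto simp: lmul_def that intro!: sum.cong)
qed

lemma insert_B: "i \<in> Y1 m n \<Longrightarrow> (\<alpha>, u) \<in> B \<Longrightarrow> (\<alpha>, insert i u) \<in> B"
  by (auto simp: LB_def)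

lemma llin_D: "llin (D i)"
  by (rule llinI) (auto simp: Dop_def fun_eq_iff algebra_simps insert_B)

lemmas mul_simps =
  llin_mul_left[THEN llin_lin, THEN lin_add] llin_mul_left[THEN llin_lin, THEN lin_diff]
  llin_mul_left[THEN llin_lin, THEN lin_sc] llin_mul_left[THEN llin_lin, THEN lin_minus]
  llin_mul_left[THEN llin_lin, THEN lin_zero]
  llin_mul_right[THEN llin_lin, THEN lin_add] llin_mul_right[THEN llin_lin, THEN lin_diff]
  llin_mul_right[THEN llin_lin, THEN lin_sc] llin_mul_right[THEN llin_lin, THEN lin_minus]
  llin_mul_right[THEN llin_lin, THEN lin_zero]

lemmas mul_sum = llin_mul_left[THEN llin_lin, THEN lin_sum] llin_mul_right[THEN llin_lin, THEN lin_sum]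

lemmas D_simps =
  llin_D[THEN llin_lin, THEN lin_add] llin_D[THEN llin_lin, THEN lin_diff]
  llin_D[THEN llin_lin, THEN lin_sc] llin_D[THEN llin_lin, THEN lin_minus]
  llin_D[THEN llin_lin, THEN lin_zero]

lemmas D_sum = llin_D[THEN llin_lin, THEN lin_sum]

section \<open>Associativity and supercommutativity of the product\<close>

lemma mul_mono:
  assumes "b \<in> B" "c \<in> B"
  shows "xm b \<cdot> xm c = (if madd b c \<in> B then sc (mcoef m b c) (xm (madd b c)) else 0)"
proof
  fix z
  have e: "(\<lambda>i. fst b i + fst c i) = fst z \<and> snd b \<union> snd c = snd z \<longleftrightarrow> z = madd b c" for b c :: mon
    by (auto simp: madd_def prod_eq_iff)
  have "(xm b \<cdot> xm c) z = (if z \<in> B then (\<Sum>b'\<in>B. \<Sum>c'\<in>B. if c' = c then (if b' = b then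
       (if z = madd b c then mcoef m b c else 0) else 0) else 0) else 0)"
    unfolding lmul_def e by (auto simp: mono1_def intro!: sum.cong)
  also have "\<dots> = (if z \<in> B then if z = madd b c then mcoef m b c else 0 else 0)"
    using assms by (simp add: sum.delta finite_B)
  finally show "(xm b \<cdot> xm c) z = (if madd b c \<in> B then sc (mcoef m b c) (xm (madd b c)) else 0) z"
    by (auto simp: mono1_def)
qed

lemma mcoef_eq_0: "snd b \<inter> snd c \<noteq> {} \<Longrightarrow> mcoef m b c = 0"
  by (simp add: mcoef_def)

text \<open>Binomial parts agree by the trinomial identity, and inversion counts are additive over
  disjoint unions. If two of the three Grassmann parts meet, both sides vanish.\<close>

lemma mcoef_assoc:
  assumes "b \<in> B" "c \<in> B" "d \<in> B"
  shows "mcoef m b c * mcoef m (madd b c) d = (mcoef m c d * mcoef m b (madd c d) :: 'a)"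
proof (cases "snd b \<inter> snd c = {} \<and> snd b \<inter> snd d = {} \<and> snd c \<inter> snd d = {}")
  case True
  have "(\<Prod>i\<in>Y0 m. (fst b i + fst c i) choose (fst b i)) *
     (\<Prod>i\<in>Y0 m. (fst b i + fst c i + fst d i) choose (fst b i + fst c i)) =
     (\<Prod>i\<in>Y0 m. (fst c i + fst d i) choose (fst c i)) *
     (\<Prod>i\<in>Y0 m. (fst b i + (fst c i + fst d i)) choose (fst b i))"
    unfolding prod.distrib[symmetric]
    by (rule prod.cong[OF refl]) (simp only: add.assoc[symmetric], rule choose_assoc)
  note 1 = arg_cong[OF this, of "of_nat :: nat \<Rightarrow> 'a", unfolded of_nat_mult]
  have "ninv (snd b) (snd c) + ninv (snd b \<union> snd c) (snd d) = ninv (snd c) (snd d) + ninv (snd b) (snd c \<union> snd d)"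
    using True fin_snd assms by (simp add: ninv_Un_left ninv_Un_right)
  note 2 = arg_cong[OF this, of "\<lambda>k. (-1::'a) ^ k", unfolded power_add]
  have rearr: "u * s * (v * t) = w * q * (y * r)" if "u * v = w * y" "s * t = q * r" for u s v t w q y r :: 'a
    using that by (metis mult.assoc mult.left_commute)
  have "snd (madd b c) \<inter> snd d = {}" "snd b \<inter> snd (madd c d) = {}" using True by auto
  then show ?thesis using True unfolding mcoef_def sgnmon_ninv
    by (simp only: if_True madd_simps simp_thms) (rule rearr[OF 1 2])
next
  case False
  then have "snd b \<inter> snd c \<noteq> {} \<or> snd (madd b c) \<inter> snd d \<noteq> {}"
    "snd c \<inter> snd d \<noteq> {} \<or> snd b \<inter> snd (madd c d) \<noteq> {}" by auto
  then show ?thesis by (metis mcoef_eq_0 mult_zero_left mult_zero_right)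
qed

text \<open>\<open>B\<close> is closed under divisors: if the triple product stays in
  \<open>B\<close>, so do both partial products and \<open>mcoef_assoc\<close> applies; otherwise
  both sides are cut off to zero. The identity is then extended linearly, one factor at a
  time.\<close>

lemma mul_assoc: "f \<cdot> g \<cdot> h = f \<cdot> (g \<cdot> h)"
proof -
  have 0: "xm b \<cdot> xm c \<cdot> xm d = xm b \<cdot> (xm c \<cdot> xm d)" if "b \<in> B" "c \<in> B" "d \<in> B" for b c d
  proof (cases "madd b (madd c d) \<in> B")
    case True
    then have "madd b c \<in> B" "madd c d \<in> B"
      using madd_B_left[of "madd b c" d] madd_B_left[of "madd c d" b]
      by (simp_all only: madd_assoc madd_comm[of _ b])
    then show ?thesis using that mcoef_assoc[OF that] by (simp add: mul_mono mul_simps True madd_assoc)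
  next
    case False
    then show ?thesis using that by (auto simp: mul_mono mul_simps madd_assoc)
  qed
  have 1: "xm b \<cdot> xm c \<cdot> h = xm b \<cdot> (xm c \<cdot> h)" if "b \<in> B" "c \<in> B" for b c
    by (rule llin_eqI[OF llin_mul_right llin_comp[OF llin_mul_right[THEN llin_lin] llin_mul_right]]) (intro 0 that)+
  have 2: "xm b \<cdot> g \<cdot> h = xm b \<cdot> (g \<cdot> h)" if "b \<in> B" for b
    by (rule llin_eqI[OF llin_comp[OF llin_mul_left[THEN llin_lin] llin_mul_right]
          llin_comp[OF llin_mul_right[THEN llin_lin] llin_mul_left]]) (intro 1 that)+
  show ?thesis
    by (rule llin_eqI[OF llin_comp[OF llin_mul_left[THEN llin_lin] llin_mul_left] llin_mul_left]) (rule 2)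
qed

text \<open>Both sides are reduced mod 2, so sums of parities such as \<open>a + tau m i\<close> can
  be used unreduced. In contrast, \<open>homW\<close> requires its parity to be a residue, which is
  why \<open>hw\<close> below includes \<open>a < 2\<close>.\<close>

definition homL :: "nat \<Rightarrow> 'a lam \<Rightarrow> bool" where
  "homL d f \<longleftrightarrow> (\<forall>b. f b \<noteq> 0 \<longrightarrow> (card (snd b) mod 2 = d mod 2))"

lemma mcoef_comm:
  assumes "b \<in> B" "c \<in> B"
  shows "mcoef m b c = (-1) ^ (card (snd b) * card (snd c)) * (mcoef m c b :: 'a)"
proof (cases "snd b \<inter> snd c = {}")
  case True
  have "(\<Prod>i\<in>Y0 m. (fst b i + fst c i) choose (fst b i)) = (\<Prod>i\<in>Y0 m. (fst c i + fst b i) choose (fst c i))"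
    by (rule prod.cong[OF refl]) (metis add.commute add_diff_cancel_left' binomial_symmetric le_add1)
  moreover have "(-1::'a) ^ ninv (snd b) (snd c) = (-1) ^ (card (snd b) * card (snd c) + ninv (snd c) (snd b))"
    using ninv_swap[OF fin_snd[OF assms(1)] fin_snd[OF assms(2)] True]
    by (intro minus_one_power_eqI) presburger
  ultimately show ?thesis using True
    by (simp add: mcoef_def sgnmon_ninv Int_commute power_add del: of_nat_prod)
next
  case False
  then show ?thesis by (simp add: mcoef_eq_0 Int_commute)
qed

lemma mul_comm:
  assumes "homL a f" "homL b g"
  shows "f \<cdot> g = sc ((-1) ^ (a * b)) (g \<cdot> f)"
proof -
  have 0: "xm u \<cdot> xm v = sc ((-1) ^ (a * b)) (xm v \<cdot> xm u)" if "u \<in> B" "v \<in> B" "f u \<noteq> 0" "g v \<noteq> 0" for u v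
  proof -
    have "card (snd u) mod 2 = a mod 2" "card (snd v) mod 2 = b mod 2" using assms that unfolding homL_def by blast+
    then have "(-1::'a) ^ (card (snd u) * card (snd v)) = (-1) ^ (a * b)"
      by (intro minus_one_power_eqI) (auto simp: mod_2_eq_odd split: if_splits)
    then show ?thesis using that mcoef_comm[of u v] by (simp add: mul_mono madd_comm)
  qed
  have 1: "xm u \<cdot> g = sc ((-1) ^ (a * b)) (g \<cdot> xm u)" if "u \<in> B" "f u \<noteq> 0" for u
    by (rule llin_eqI[OF llin_mul_right llin_sc[OF llin_mul_left]]) (intro 0 that)+
  show ?thesis
    by (rule llin_eqI[OF llin_mul_left llin_sc[OF llin_mul_right]]) (intro 1)
qed


section \<open>Partial derivatives as commuting superderivations\<close>

lemma B_iff: "b \<in> B \<longleftrightarrow> (\<forall>i\<in>Y0 m. fst b i < p ^ tt i) \<and> (\<forall>i. i \<notin> Y0 m \<longrightarrow> fst b i = 0) \<and> snd b \<subseteq> Y1 m n"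
proof -
  have "0 < p" using p_gt_2 by simp
  then have "a \<le> p ^ t - 1 \<longleftrightarrow> a < p ^ t" for a t
    using zero_less_power[of p t] by linarith
  then show ?thesis by (cases b) (simp add: LB_def)
qed

definition dec :: "nat \<Rightarrow> mon \<Rightarrow> mon" where
  "dec i b = ((fst b)(i := fst b i - 1), snd b)"

lemma dec_simps [simp]: "fst (dec i b) j = (if j = i then fst b i - 1 else fst b j)" "snd (dec i b) = snd b"
  by (auto simp: dec_def)

definition del :: "nat \<Rightarrow> mon \<Rightarrow> mon" where
  "del i b = (fst b, snd b - {i})"

lemma del_simps [simp]: "fst (del i b) = fst b" "snd (del i b) = snd b - {i}"
  by (auto simp: del_def)

lemma mon_eqI: "(\<And>i. fst b i = fst c i) \<Longrightarrow> snd b = snd c \<Longrightarrow> b = (c :: mon)"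
  by (auto simp: prod_eq_iff)

lemma dec_B: "b \<in> B \<Longrightarrow> dec i b \<in> B"
  by (auto simp: B_iff less_imp_diff_less)

lemma del_B: "b \<in> B \<Longrightarrow> del i b \<in> B"
  by (auto simp: B_iff)

lemma D_even_mono:
  assumes "b \<in> B" "i \<in> Y0 m"
  shows "D i (xm b) = (if fst b i = 0 then 0 else xm (dec i b))"
proof
  fix z :: mon
  obtain \<alpha> u where z: "z = (\<alpha>, u)" by (cases z)
  have "(\<alpha>(i := \<alpha> i + 1), u) = b \<longleftrightarrow> fst b i \<noteq> 0 \<and> (\<alpha>, u) = dec i b"
    by (cases b) (auto simp: dec_def fun_eq_iff)
  moreover have "dec i b \<in> B" using assms dec_B by blast
  ultimately show "D i (xm b) z = (if fst b i = 0 then 0 else xm (dec i b)) z"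
    using assms by (auto simp: z Dop_def mono1_def)
qed

lemma Y_disjoint: "Y0 m \<inter> Y1 m n = {}"
  by (auto simp: Y0_def Y1_def)

lemma YY_eq: "YY m n = Y0 m \<union> Y1 m n"
  by (auto simp: Y0_def Y1_def YY_def)

lemma D_odd_mono:
  assumes "b \<in> B" "i \<in> Y1 m n"
  shows "D i (xm b) = (if i \<in> snd b then sc ((-1) ^ ninv {i} (snd b)) (xm (del i b)) else 0)"
proof
  fix z :: mon
  obtain \<alpha> u where z: "z = (\<alpha>, u)" by (cases z)
  have i: "i \<notin> Y0 m" using assms Y_disjoint by auto
  have eq: "i \<notin> u \<and> (\<alpha>, insert i u) = b \<longleftrightarrow> i \<in> snd b \<and> (\<alpha>, u) = del i b"
    by (cases b) (auto simp: del_def fun_eq_iff)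
  have in_B: "del i b \<in> B" using assms del_B by blast
  have s: "{j \<in> u. j < i} = {j \<in> insert i u. j < i}" by auto
  have "D i (xm b) z = (if z \<in> B \<and> i \<notin> u then (-1) ^ card {j \<in> insert i u. j < i} * xm b (\<alpha>, insert i u) else 0)"
    using assms(2) i by (simp add: z Dop_def s[symmetric] del: insert_iff)
  also have "\<dots> = (if i \<in> snd b \<and> z = del i b then (-1) ^ ninv {i} (snd b) else 0)"
  proof (cases "i \<in> snd b \<and> z = del i b")
    case True
    then have "i \<notin> u" "(\<alpha>, insert i u) = b" using eq z by auto
    moreover from this have "snd b = insert i u" by auto
    ultimately show ?thesis using True in_B by (simp add: ninv_singleton_left mono1_def)
  next
    case False
    then have "i \<in> u \<or> (\<alpha>, insert i u) \<noteq> b" using eq z by blast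
    then show ?thesis using False by (auto simp: mono1_def)
  qed
  finally show "D i (xm b) z = (if i \<in> snd b then sc ((-1) ^ ninv {i} (snd b)) (xm (del i b)) else 0) z"
    by (simp add: mono1_def)
qed

lemma D_outside: "i \<notin> YY m n \<Longrightarrow> D i f = 0"
  by (auto simp: Dop_def fun_eq_iff YY_eq)

text \<open>The structure constant without its binomial factor for the variable \<open>i\<close>, so
  that differentiating in \<open>x_i\<close> changes only the removed factor.\<close>

definition mcoef' :: "nat \<Rightarrow> mon \<Rightarrow> mon \<Rightarrow> 'a" where
  "mcoef' i b c = (if snd b \<inter> snd c = {}
      then of_nat (\<Prod>j\<in>Y0 m - {i}. (fst b j + fst c j) choose (fst b j)) * sgnmon (snd b) (snd c)
      else 0)"

lemma mcoef_split:
  assumes "i \<in> Y0 m"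
  shows "mcoef m b c = of_nat ((fst b i + fst c i) choose fst b i) * mcoef' i b c"
proof -
  have "finite (Y0 m)" by (simp add: Y0_def)
  then have "(\<Prod>j\<in>Y0 m. (fst b j + fst c j) choose (fst b j)) =
    ((fst b i + fst c i) choose fst b i) * (\<Prod>j\<in>Y0 m - {i}. (fst b j + fst c j) choose (fst b j))"
    using assms by (rule prod.remove)
  then show ?thesis by (simp add: mcoef_def mcoef'_def mult.assoc del: of_nat_prod)
qed

lemma mcoef'_cong:
  assumes "\<And>j. j \<noteq> i \<Longrightarrow> fst b j = fst b' j" "\<And>j. j \<noteq> i \<Longrightarrow> fst c j = fst c' j"
    "snd b = snd b'" "snd c = snd c'"
  shows "mcoef' i b c = mcoef' i b' c'"
proof -
  have "(\<Prod>j\<in>Y0 m - {i}. (fst b j + fst c j) choose (fst b j)) =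
     (\<Prod>j\<in>Y0 m - {i}. (fst b' j + fst c' j) choose (fst b' j))"
    using assms by (intro prod.cong) auto
  then show ?thesis unfolding mcoef'_def assms(3,4) by simp
qed

lemma D_mul_even_mono:
  assumes b: "b \<in> B" and c: "c \<in> B" and i: "i \<in> Y0 m"
  shows "D i (xm b \<cdot> xm c) = D i (xm b) \<cdot> xm c + xm b \<cdot> D i (xm c)"
proof -
  define P where "P = mcoef' i b c"
  define z where "z = dec i (madd b c)"
  let ?b = "fst b i" and ?c = "fst c i"
  have P1: "mcoef' i (dec i b) c = P" "mcoef' i b (dec i c) = P"
    unfolding P_def by (rule mcoef'_cong; simp)+
  have z1: "madd (dec i b) c = z" if "?b > 0"
    unfolding z_def using that by (intro mon_eqI) auto
  have z2: "madd b (dec i c) = z" if "?c > 0"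
    unfolding z_def using that by (intro mon_eqI) auto
  have lhs: "D i (xm b \<cdot> xm c) = (if madd b c \<in> B \<and> ?b + ?c > 0 then sc (of_nat ((?b + ?c) choose ?b) * P) (xm z) else 0)"
    using b c i by (simp add: mul_mono D_simps D_even_mono mcoef_split[OF i] P_def z_def)
  have r1: "D i (xm b) \<cdot> xm c = (if ?b > 0 \<and> z \<in> B then sc (of_nat ((?b - 1 + ?c) choose (?b - 1)) * P) (xm z) else 0)"
    using b c i z1 by (auto simp add: mul_mono mul_simps D_even_mono mcoef_split[OF i] P1 dec_B)
  have r2: "xm b \<cdot> D i (xm c) = (if ?c > 0 \<and> z \<in> B then sc (of_nat ((?b + (?c - 1)) choose ?b) * P) (xm z) else 0)"
    using b c i z2 by (auto simp add: mul_mono mul_simps D_even_mono mcoef_split[OF i] P1 dec_B)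
  \<comment> \<open>This is Pascal's rule in the \<open>i\<close>-th exponent. A vanishing exponent
    is treated separately, since there the subtraction of 1 is cut off and one summand is
    absent.\<close>
  have pascal: "D i (xm b) \<cdot> xm c + xm b \<cdot> D i (xm c) =
     (if ?b + ?c > 0 \<and> z \<in> B then sc (of_nat ((?b + ?c) choose ?b) * P) (xm z) else 0)"
  proof (cases "?b > 0 \<and> ?c > 0")
    case True
    then obtain b' c' where bc: "?b = Suc b'" "?c = Suc c'" by (metis not0_implies_Suc neq0_conv)
    show ?thesis unfolding r1 r2 using True by (auto simp: bc sc_add_left[symmetric] distrib_right[symmetric] add_ac)
  next
    case False
    then show ?thesis unfolding r1 r2 by auto
  qed
  have "madd b c \<in> B \<Longrightarrow> z \<in> B" using dec_B by (simp add: z_def)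
  \<comment> \<open>The product is truncated but its derivative is not exactly when the exponents add up to \<open>p ^ tt i\<close>.\<close>
  moreover have "of_nat ((?b + ?c) choose ?b) = (0::'a)" if "?b + ?c > 0" "z \<in> B" "madd b c \<notin> B"
  proof -
    have bnd: "?b < p ^ tt i" "?c < p ^ tt i" using b c i by (auto simp: B_iff)
    have "fst z j = fst b j + fst c j" if "j \<noteq> i" for j using that by (simp add: z_def)
    then have "\<not> ?b + ?c < p ^ tt i"
      using that i unfolding B_iff by (metis madd_simps dec_simps(2) z_def)
    moreover have "?b + ?c - 1 < p ^ tt i" using that i unfolding B_iff by (metis madd_simps(1) dec_simps(1) z_def)
    ultimately have e: "?b + ?c = p ^ tt i" by linarith
    have "p dvd (p ^ tt i choose ?b)" using bnd e by (intro prime_dvd_choose_prime_power[OF prime_p]) auto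
    then show ?thesis unfolding e using char_p by (simp add: of_nat_eq_0_iff_char_dvd)
  qed
  ultimately show ?thesis unfolding lhs pascal by auto
qed

definition mc0 :: "mon \<Rightarrow> mon \<Rightarrow> 'a" where
  "mc0 b c = of_nat (\<Prod>i\<in>Y0 m. (fst b i + fst c i) choose (fst b i))"

lemma mcoef_mc0: "mcoef m b c = (if snd b \<inter> snd c = {} then mc0 b c * (-1) ^ ninv (snd b) (snd c) else 0)"
  by (simp add: mcoef_def mc0_def sgnmon_ninv)

lemma mc0_del [simp]: "mc0 (del i b) c = mc0 b c" "mc0 b (del i c) = mc0 b c"
  by (simp_all add: mc0_def)

lemma madd_del_B: "b \<in> B \<Longrightarrow> c \<in> B \<Longrightarrow> madd (del i b) c \<in> B \<longleftrightarrow> madd b c \<in> B"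
  "b \<in> B \<Longrightarrow> c \<in> B \<Longrightarrow> madd b (del i c) \<in> B \<longleftrightarrow> madd b c \<in> B"
  by (auto simp: B_iff)

text \<open>With \<open>i\<close> removed from both index sets, each sign becomes a sum of inversion
  counts of \<open>{i}\<close>, \<open>u\<close> and \<open>v\<close>. The case \<open>both\<close>
  is special: the product is zero, and the two terms of the Leibniz rule cancel each other.\<close>

lemma D_mul_odd_mono:
  assumes b: "b \<in> B" and c: "c \<in> B" and i: "i \<in> Y1 m n"
  shows "D i (xm b \<cdot> xm c) = D i (xm b) \<cdot> xm c + sc ((-1) ^ card (snd b)) (xm b \<cdot> D i (xm c))"
proof -
  let ?u = "snd b" and ?v = "snd c"
  define u v where "u = snd b - {i}" and "v = snd c - {i}"
  have fin: "finite u" "finite v" using fin_snd b c by (auto simp: u_def v_def)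
  have iuv: "i \<notin> u" "i \<notin> v" by (auto simp: u_def v_def)
  have sw: "ninv u {i} + ninv {i} u = card u"
    using ninv_swap[of u "{i}"] fin iuv by simp
  have ii: "ninv {i} {i} = 0" by (simp add: ninv_singleton_left)
  have il: "ninv (insert i u) w = ninv {i} w + ninv u w" if "finite w" for w
    using ninv_Un_left[of "{i}" u w] fin iuv that by simp
  have ir: "ninv w (insert i v) = ninv w {i} + ninv w v" if "finite w" for w
    using ninv_Un_right[of w "{i}" v] fin iuv that by simp
  have ir': "ninv w (insert i u) = ninv w {i} + ninv w u" if "finite w" for w
    using ninv_Un_right[of w "{i}" u] fin iuv that by simp
  have iu: "ninv w (u \<union> v) = ninv w u + ninv w v" if "finite w" "u \<inter> v = {}" for w
    using ninv_Un_right[of w u v] fin iuv that by simp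
  have lhs: "D i (xm b \<cdot> xm c) = (if madd b c \<in> B \<and> i \<in> ?u \<union> ?v \<and> ?u \<inter> ?v = {} then
     sc (mc0 b c * (-1) ^ (ninv ?u ?v + ninv {i} (?u \<union> ?v))) (xm (del i (madd b c))) else 0)"
    using b c i by (simp add: mul_mono D_simps D_odd_mono mcoef_mc0 power_add mult.assoc)
  have r1: "D i (xm b) \<cdot> xm c = (if madd b c \<in> B \<and> i \<in> ?u \<and> u \<inter> ?v = {} then
     sc (mc0 b c * (-1) ^ (ninv {i} ?u + ninv u ?v)) (xm (madd (del i b) c)) else 0)"
    using b c i by (simp add: mul_mono mul_simps D_odd_mono mcoef_mc0 power_add mult.left_commute del_B madd_del_B u_def)
  have r2: "xm b \<cdot> D i (xm c) = (if madd b c \<in> B \<and> i \<in> ?v \<and> ?u \<inter> v = {} then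
     sc (mc0 b c * (-1) ^ (ninv {i} ?v + ninv ?u v)) (xm (madd b (del i c))) else 0)"
    using b c i by (simp add: mul_mono mul_simps D_odd_mono mcoef_mc0 power_add mult.left_commute del_B madd_del_B v_def)
  consider (none) "i \<notin> ?u" "i \<notin> ?v" | (left) "i \<in> ?u" "i \<notin> ?v" | (right) "i \<notin> ?u" "i \<in> ?v"
    | (both) "i \<in> ?u" "i \<in> ?v" by blast
  then show ?thesis
  proof cases
    case none
    then show ?thesis unfolding lhs r1 r2 by simp
  next
    case left
    have uv: "?u = insert i u" "?v = v" using left by (auto simp: u_def v_def)
    have e: "del i (madd b c) = madd (del i b) c" using left by (intro mon_eqI) auto
    have d: "?u \<inter> ?v = {} \<longleftrightarrow> u \<inter> v = {}" using uv left by auto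
    have "(-1::'a) ^ (ninv ?u ?v + ninv {i} (?u \<union> ?v)) = (-1) ^ (ninv {i} ?u + ninv u ?v)" if "u \<inter> v = {}"
      using ninv_Un_right[of "{i}" ?u ?v] that fin iuv left
      by (intro minus_one_power_eqI) (auto simp: uv il)
    then show ?thesis unfolding lhs r1 r2 e d using left uv by auto
  next
    case right
    have uv: "?u = u" "?v = insert i v" using right by (auto simp: u_def v_def)
    have e: "del i (madd b c) = madd b (del i c)" using right by (intro mon_eqI) auto
    have d: "?u \<inter> ?v = {} \<longleftrightarrow> u \<inter> v = {}" using uv right by auto
    have "(-1::'a) ^ (ninv ?u ?v + ninv {i} (?u \<union> ?v)) = (-1) ^ (card ?u + (ninv {i} ?v + ninv ?u v))" if "u \<inter> v = {}"
      using ninv_Un_right[of "{i}" ?u ?v] that fin iuv right sw[symmetric]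
      by (intro minus_one_power_eqI) (auto simp: uv ir)
    then show ?thesis unfolding lhs r1 r2 e d using right uv by (auto simp: power_add mult_ac)
  next
    case both
    have uv: "?u = insert i u" "?v = insert i v" using both by (auto simp: u_def v_def)
    have e: "madd (del i b) c = madd b (del i c)" using both by (intro mon_eqI) auto
    have d: "?u \<inter> ?v \<noteq> {}" "u \<inter> ?v = {} \<longleftrightarrow> u \<inter> v = {}" "?u \<inter> v = {} \<longleftrightarrow> u \<inter> v = {}" using uv both iuv by auto
    have "(-1::'a) ^ (card ?u + (ninv {i} ?v + ninv ?u v)) = (-1) ^ Suc (ninv {i} ?u + ninv u ?v)" if "u \<inter> v = {}"
      using that fin iuv sw[symmetric]
      by (intro minus_one_power_eqI) (auto simp: uv ir ir' il ii)
    then show ?thesis unfolding lhs r1 r2 e using d both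
      by (auto simp: power_add mult_ac sc_add_left[symmetric])
  qed
qed

lemma tau_odd: "i \<in> Y1 m n \<Longrightarrow> tau m i = 1"
  using Y_disjoint by (auto simp: tau_def)

lemma tau_even: "i \<in> Y0 m \<Longrightarrow> tau m i = 0"
  by (auto simp: tau_def)

lemma D_mul:
  assumes "homL a f"
  shows "D i (f \<cdot> g) = D i f \<cdot> g + sc ((-1) ^ (tau m i * a)) (f \<cdot> D i g)"
proof (cases "i \<in> YY m n")
  case True
  have 0: "D i (xm b \<cdot> xm c) = D i (xm b) \<cdot> xm c + sc ((-1) ^ (tau m i * a)) (xm b \<cdot> D i (xm c))"
    if "b \<in> B" "c \<in> B" "f b \<noteq> 0" for b c
  proof (cases "i \<in> Y0 m")
    case True
    then show ?thesis using D_mul_even_mono[OF that(1,2)] by (simp add: tau_even)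
  next
    case False
    then have i: "i \<in> Y1 m n" using \<open>i \<in> YY m n\<close> by (simp add: YY_eq)
    have "card (snd b) mod 2 = a mod 2" using assms that unfolding homL_def by blast
    then have "(-1::'a) ^ card (snd b) = (-1) ^ (tau m i * a)"
      by (intro minus_one_power_eqI) (auto simp: mod_2_eq_odd tau_odd[OF i] split: if_splits)
    then show ?thesis using D_mul_odd_mono[OF that(1,2) i] by simp
  qed
  note ll = llin_comp[OF llin_D[THEN llin_lin] llin_mul_right] llin_comp[OF llin_D[THEN llin_lin] llin_mul_left]
  have 1: "D i (xm b \<cdot> g) = D i (xm b) \<cdot> g + sc ((-1) ^ (tau m i * a)) (xm b \<cdot> D i g)"
    if "b \<in> B" "f b \<noteq> 0" for b
    by (rule llin_eqI[OF ll(1) llin_add[OF llin_mul_right llin_sc[OF llin_comp[OF llin_mul_right[THEN llin_lin] llin_D]]]])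
      (intro 0 that)
  show ?thesis
    by (rule llin_eqI[OF ll(2) llin_add[OF llin_comp[OF llin_mul_left[THEN llin_lin] llin_D] llin_sc[OF llin_mul_left]]])
      (intro 1)
next
  case False
  then show ?thesis by (simp add: D_outside mul_simps)
qed

lemma D_comm: "D i (D j f) = sc ((-1) ^ (tau m i * tau m j)) (D j (D i f))"
proof (cases "i \<in> YY m n \<and> j \<in> YY m n")
  case True
  have ee: "D i (D j (xm b)) = D j (D i (xm b))" if "b \<in> B" "i \<in> Y0 m" "j \<in> Y0 m" for b i j
  proof (cases "i = j")
    case False
    then have "dec i (dec j b) = dec j (dec i b)" by (intro mon_eqI) auto
    then show ?thesis using False that by (simp add: D_even_mono D_simps dec_B)
  qed simp
  have eo: "D i (D j (xm b)) = D j (D i (xm b))" if "b \<in> B" "i \<in> Y0 m" "j \<in> Y1 m n" for b i j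
  proof -
    have "dec i (del j b) = del j (dec i b)" by (intro mon_eqI) auto
    then show ?thesis using that by (simp add: D_even_mono D_odd_mono D_simps dec_B del_B)
  qed
  have oo: "D i (D j (xm b)) = - D j (D i (xm b))" if b: "b \<in> B" and "i \<in> Y1 m n" "j \<in> Y1 m n" for b i j
  proof (cases "i \<noteq> j \<and> i \<in> snd b \<and> j \<in> snd b")
    case True
    define u where "u = snd b - {i, j}"
    have u: "snd b = insert i (insert j u)" "i \<notin> u" "j \<notin> u" "finite u" using True fin_snd[OF b] by (auto simp: u_def)
    have d: "snd b - {j} = insert i u" "snd b - {i} = insert j u" using u True by auto
    have e: "ninv {k} ({l} \<union> w) = ninv {k} {l} + ninv {k} w" if "l \<notin> w" "finite w" for k l w
      using ninv_Un_right[of "{k}" "{l}" w] that by simp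
    have "ninv {k} (snd b) = ninv {k} {i} + (ninv {k} {j} + ninv {k} u)"
      "ninv {k} (insert i u) = ninv {k} {i} + ninv {k} u"
      "ninv {k} (insert j u) = ninv {k} {j} + ninv {k} u" for k
      using u True e[of i "insert j u" k] e[of j u k] e[of i u k] by (simp_all add: insert_commute)
    moreover have "ninv {k} {k} = 0" for k by (simp add: ninv_singleton_left)
    \<comment> \<open>Exactly one of the two orders of \<open>i\<close> and \<open>j\<close> is an
      inversion; this single unit is the anticommutation sign.\<close>
    moreover have "ninv {i} {j} + ninv {j} {i} = 1" using ninv_swap[of "{i}" "{j}"] True by simp
    ultimately have "(-1::'a) ^ (ninv {j} (snd b) + ninv {i} (snd b - {j})) = (-1) ^ Suc (ninv {i} (snd b) + ninv {j} (snd b - {i}))"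
      unfolding d by (intro minus_one_power_eqI) (simp, presburger)
    moreover have "del i (del j b) = del j (del i b)" by (intro mon_eqI) auto
    ultimately show ?thesis using True that by (simp add: D_odd_mono D_simps del_B power_add)
  next
    case False
    then show ?thesis using that del_B[OF b]
      by (cases "i = j"; cases "i \<in> snd b"; cases "j \<in> snd b") (simp_all add: D_odd_mono D_simps)
  qed
  have 0: "D i (D j (xm b)) = sc ((-1) ^ (tau m i * tau m j)) (D j (D i (xm b)))" if "b \<in> B" for b
  proof -
    consider "i \<in> Y0 m" "j \<in> Y0 m" | "i \<in> Y0 m" "j \<in> Y1 m n" | "i \<in> Y1 m n" "j \<in> Y0 m"
      | "i \<in> Y1 m n" "j \<in> Y1 m n" using True unfolding YY_eq by blast
    then show ?thesis
    proof cases
      case 1 then show ?thesis using ee[OF that 1] by (simp add: tau_even)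
    next
      case 2 then show ?thesis using eo[OF that 2] by (simp add: tau_even)
    next
      case 3 then show ?thesis using eo[OF that 3(2,1)] by (simp add: tau_even)
    next
      case 4 then show ?thesis using oo[OF that 4] by (simp add: tau_odd)
    qed
  qed
  note ll = llin_comp[OF llin_D[THEN llin_lin] llin_D]
  show ?thesis by (rule llin_eqI[OF ll llin_sc[OF ll]]) (rule 0)
next
  case False
  then show ?thesis by (auto simp: D_outside D_simps)
qed


section \<open>Parity under products and derivatives\<close>

lemma homL_mod: "homL a f \<Longrightarrow> a mod 2 = b mod 2 \<Longrightarrow> homL b f"
  by (simp add: homL_def)

lemma homL_0 [simp]: "homL a 0"
  by (simp add: homL_def)

lemma homL_add: "homL a f \<Longrightarrow> homL a g \<Longrightarrow> homL a (f + g)"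
  unfolding homL_def by (metis add.right_neutral plus_fun_apply)

lemma homL_sc: "homL a f \<Longrightarrow> homL a (sc c f)"
  unfolding homL_def sc_apply by (metis mult_zero_right)

lemma homL_diff: "homL a f \<Longrightarrow> homL a g \<Longrightarrow> homL a (f - g)"
  using homL_add[of a f "sc (-1) g"] homL_sc[of a g "-1"] by simp

lemma homL_sum: "(\<And>i. i \<in> I \<Longrightarrow> homL a (f i)) \<Longrightarrow> homL a (\<Sum>i\<in>I. f i)"
  by (induction I rule: infinite_finite_induct) (simp_all add: homL_add)

lemma homL_mul:
  assumes "homL a f" "homL b g"
  shows "homL (a + b) (f \<cdot> g)"
  unfolding homL_def
proof (intro allI impI)
  fix z assume z: "(f \<cdot> g) z \<noteq> 0"
  let ?t = "\<lambda>u v. if (\<lambda>i. fst u i + fst v i) = fst z \<and> snd u \<union> snd v = snd z then f u * g v * mcoef m u v else 0"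
  have "(\<Sum>u\<in>B. \<Sum>v\<in>B. ?t u v) \<noteq> 0" using z unfolding lmul_def by (auto split: if_splits)
  then obtain u where u: "u \<in> B" "(\<Sum>v\<in>B. ?t u v) \<noteq> 0" by (rule sum.not_neutral_contains_not_neutral)
  from u(2) obtain v where v: "v \<in> B" "?t u v \<noteq> 0" by (rule sum.not_neutral_contains_not_neutral)
  then have e: "snd u \<union> snd v = snd z" "f u \<noteq> 0" "g v \<noteq> 0" "mcoef m u v \<noteq> (0::'a)" by (auto split: if_splits)
  then have "snd u \<inter> snd v = {}" using mcoef_eq_0[of u v] by blast
  then have "card (snd z) = card (snd u) + card (snd v)"
    using card_Un_disjoint[OF fin_snd[OF u(1)] fin_snd[OF v(1)]] e(1) by simp
  moreover have "card (snd u) mod 2 = a mod 2" "card (snd v) mod 2 = b mod 2"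
    using assms e(2,3) unfolding homL_def by blast+
  ultimately show "card (snd z) mod 2 = (a + b) mod 2" by (metis mod_add_eq)
qed

lemma homL_D:
  assumes "homL a f"
  shows "homL (a + tau m i) (D i f)"
  unfolding homL_def
proof (intro allI impI)
  fix z assume z: "D i f z \<noteq> 0"
  obtain \<alpha> u where zz: "z = (\<alpha>, u)" by (cases z)
  show "card (snd z) mod 2 = (a + tau m i) mod 2"
  proof (cases "i \<in> Y0 m")
    case True
    then have "f (\<alpha>(i := \<alpha> i + 1), u) \<noteq> 0" using z by (auto simp: zz Dop_def split: if_splits)
    then have "card u mod 2 = a mod 2" using assms unfolding homL_def by (metis snd_conv)
    then show ?thesis using True by (simp add: zz tau_even)
  next
    case False
    then have n: "f (\<alpha>, insert i u) \<noteq> 0" "i \<in> Y1 m n" "i \<notin> u" "(\<alpha>, u) \<in> B"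
      using z by (auto simp: zz Dop_def split: if_splits)
    then have "card (insert i u) mod 2 = a mod 2" using assms unfolding homL_def by (metis snd_conv)
    then have "Suc (card u) mod 2 = a mod 2" using n fin_snd[OF n(4)] by simp
    then show ?thesis using n by (simp add: zz tau_odd) presburger
  qed
qed

section \<open>The Witt superalgebra\<close>

text \<open>The field \<open>X\<close> as a differential operator on \<open>Lambda\<close>. Bracket
  computations are carried out through this action instead of the fourfold sum in
  \<open>brW\<close>.\<close>

definition act :: "'a wel \<Rightarrow> 'a lam \<Rightarrow> 'a lam" where
  "act X f = (\<Sum>i\<in>YY m n. X i \<cdot> D i f)"

lemma lin_act: "lin (act X)"
  by (simp add: lin_def act_def mul_simps D_simps sum.distrib sc_sum)

lemmas act_simps = lin_act[THEN lin_add] lin_act[THEN lin_diff] lin_act[THEN lin_sc]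
  lin_act[THEN lin_minus] lin_act[THEN lin_zero]

lemma homW_homL: "d < 2 \<Longrightarrow> homW m d X \<longleftrightarrow> (\<forall>i. homL (d + tau m i) (X i))"
proof -
  assume "d < 2"
  then have "(k + t) mod 2 = d \<longleftrightarrow> k mod 2 = (d + t) mod 2" for k t :: nat by presburger
  then show ?thesis by (auto simp: homW_def homL_def)
qed

text \<open>Selects the functions that really represent elements of the Witt superalgebra; the type
  also contains coefficients outside \<open>B\<close> and components outside
  \<open>YY m n\<close>.\<close>

definition inW :: "'a wel \<Rightarrow> bool" where
  "inW X \<longleftrightarrow> (\<forall>k. inLam p m n tt (X k)) \<and> (\<forall>k. k \<notin> YY m n \<longrightarrow> X k = 0)"

definition hw :: "nat \<Rightarrow> 'a wel \<Rightarrow> bool" where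
  "hw a X \<longleftrightarrow> a < 2 \<and> inW X \<and> homW m a X"

lemma hw_homL: "hw a X \<Longrightarrow> homL (a + tau m i) (X i)"
  unfolding hw_def using homW_homL by blast

lemma homL_act:
  assumes "hw a X" "homL b f"
  shows "homL (a + b) (act X f)"
proof -
  have "homL (a + b) (X i \<cdot> D i f)" for i
    using homL_mul[OF hw_homL[OF assms(1), of i] homL_D[OF assms(2), of i]]
    by (rule homL_mod) presburger
  then show ?thesis unfolding act_def by (intro homL_sum)
qed

abbreviation br :: "'a wel \<Rightarrow> 'a wel \<Rightarrow> 'a wel" where "br X Y \<equiv> brW p m n tt X Y"

lemma inLam_mul: "inLam p m n tt (f \<cdot> g)"
  by (simp add: inLam_def lmul_def)

lemma inLam_sum: "(\<And>i. i \<in> I \<Longrightarrow> inLam p m n tt (f i)) \<Longrightarrow> inLam p m n tt (\<Sum>i\<in>I. f i :: 'a lam)"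
  by (simp add: inLam_def sum_apply)

lemma inLam_act: "inLam p m n tt (act X f)"
  unfolding act_def by (intro inLam_sum inLam_mul)

definition br_term :: "nat \<Rightarrow> nat \<Rightarrow> nat \<Rightarrow> nat \<Rightarrow> 'a wel \<Rightarrow> 'a wel \<Rightarrow> 'a wel" where
  "br_term i j a b X Y = (\<lambda>k z.
       (if k = j then (proj a (X i) \<cdot> D i (proj b (Y j))) z else 0)
       - (-1) ^ ((a + tau m i) * (b + tau m j)) *
         (if k = i then (proj b (Y j) \<cdot> D j (proj a (X i))) z else 0))"

lemma br_br_term: "br X Y k z = (\<Sum>i\<in>YY m n. \<Sum>j\<in>YY m n. \<Sum>a\<in>{0,1}. \<Sum>b\<in>{0,1}. br_term i j a b X Y k z)"
  by (simp only: brW_def br_term_def)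

lemma inW_br: "inW (br X Y)"
proof -
  have "br_term i j a b X Y k z = 0" if "z \<notin> B" for i j a b k z
    using that by (simp add: br_term_def lmul_def)
  then have "br X Y k z = 0" if "z \<notin> B" for k z
    using that by (simp add: br_br_term)
  moreover have "br_term i j a b X Y k z = 0" if "k \<notin> YY m n" "i \<in> YY m n" "j \<in> YY m n" for i j a b k z
    using that by (auto simp: br_term_def)
  then have "br X Y k z = 0" if "k \<notin> YY m n" for k z
    using that by (simp add: br_br_term)
  ultimately show ?thesis by (auto simp: inW_def inLam_def)
qed

lemma br_outside: "k \<notin> YY m n \<Longrightarrow> br X Y k = 0"
  using inW_br unfolding inW_def by blast

lemma proj_hom:
  assumes "homL d f"
  shows "proj a f = (if a = d mod 2 then f else 0)"
proof
  fix z
  have "f z \<noteq> 0 \<Longrightarrow> card (snd z) mod 2 = d mod 2" using assms unfolding homL_def by blast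
  then show "proj a f z = (if a = d mod 2 then f else 0) z" by (auto simp: proj_def)
qed

lemma sum_delta_01:
  assumes "c0 < 2" "d0 < 2"
  shows "(\<Sum>c\<in>{0,1::nat}. \<Sum>d\<in>{0,1::nat}. if c = c0 then if d = d0 then V else 0 else 0) = (V :: 'a)"
proof -
  have "c0 = 0 \<or> c0 = 1" "d0 = 0 \<or> d0 = 1" using assms by auto
  then show ?thesis by auto
qed

text \<open>For homogeneous \<open>X\<close> the coefficient \<open>X i\<close> has parity
  \<open>a + tau m i\<close>, so only one of its parity components survives. The sum over parities
  collapses, and the double sum over indices leaves the familiar commutator of vector
  fields.\<close>

lemma br_hom:
  assumes X: "hw a X" and Y: "hw b Y"
  shows "br X Y k = act X (Y k) - sc ((-1) ^ (a * b)) (act Y (X k))"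
proof (cases "k \<in> YY m n")
  case True
  show ?thesis
  proof
    fix z
    have t: "(\<Sum>c\<in>{0,1}. \<Sum>d\<in>{0,1}. br_term i j c d X Y k z)
      = (if k = j then (X i \<cdot> D i (Y j)) z else 0) - (if k = i then (-1) ^ (a * b) * (Y j \<cdot> D j (X i)) z else 0)"
      (is "_ = ?V") for i j
    proof -
      let ?c = "(a + tau m i) mod 2" and ?d = "(b + tau m j) mod 2"
      have X1: "proj c (X i) = (if c = ?c then X i else 0)" for c
        by (rule proj_hom[OF hw_homL[OF X]])
      have Y1: "proj c (Y j) = (if c = ?d then Y j else 0)" for c
        by (rule proj_hom[OF hw_homL[OF Y]])
      \<comment> \<open>\<open>tau\<close> enters each factor twice, hence cancels mod 2.\<close>
      have "even ((?c + tau m i) * (?d + tau m j)) \<longleftrightarrow> even (a * b)"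
        unfolding even_mult_iff by presburger
      then have e: "(-1::'a) ^ ((?c + tau m i) * (?d + tau m j)) = (-1) ^ (a * b)"
        by (intro minus_one_power_eqI) (simp only: even_add)
      have "br_term i j c d X Y k z = (if c = ?c then if d = ?d then ?V else 0 else 0)" for c d
      proof (cases "c = ?c \<and> d = ?d")
        case True
        then have c: "c = ?c" "d = ?d" by auto
        show ?thesis unfolding br_term_def X1 Y1 unfolding c e by (simp only: if_True refl if_distrib[of "(*) _"] mult_zero_right)
      next
        case False
        then have "proj c (X i) = 0 \<or> proj d (Y j) = 0" using X1[of c] Y1[of d] by presburger
        then have "br_term i j c d X Y k z = 0"
          by (elim disjE) (simp_all only: br_term_def mul_simps D_simps zero_fun_apply if_cancel mult_zero_right diff_self)
        then show ?thesis using False by presburger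
      qed
      then show ?thesis
        by (simp only: sum_delta_01[of ?c ?d] mod_less_divisor[OF pos2])
    qed
    have fin: "finite (YY m n)" by (simp add: YY_def)
    have "br X Y k z = (\<Sum>i\<in>YY m n. \<Sum>j\<in>YY m n. (if k = j then (X i \<cdot> D i (Y j)) z else 0)
       - (if k = i then (-1) ^ (a * b) * (Y j \<cdot> D j (X i)) z else 0))"
      unfolding br_br_term t ..
    also have "\<dots> = (\<Sum>i\<in>YY m n. \<Sum>j\<in>YY m n. (if k = j then (X i \<cdot> D i (Y j)) z else 0))
       - (\<Sum>j\<in>YY m n. \<Sum>i\<in>YY m n. (if k = i then (-1) ^ (a * b) * (Y j \<cdot> D j (X i)) z else 0))"
      unfolding sum_subtractf by (subst (2) sum.swap) (rule refl)
    also have "\<dots> = (act X (Y k) - sc ((-1) ^ (a * b)) (act Y (X k))) z"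
      using True fin by (simp add: act_def sum_apply sum_distrib_left)
    finally show "br X Y k z = (act X (Y k) - sc ((-1) ^ (a * b)) (act Y (X k))) z" .
  qed
next
  case False
  then have "X k = 0" "Y k = 0" using X Y by (auto simp: hw_def inW_def)
  then show ?thesis using False by (simp add: br_outside act_simps)
qed

lemma hw_br:
  assumes X: "hw a X" and Y: "hw b Y"
  shows "hw ((a + b) mod 2) (br X Y)"
proof -
  have "homL ((a + b) mod 2 + tau m k) (br X Y k)" for k
  proof -
    have "homL (a + (b + tau m k)) (act X (Y k))" "homL (b + (a + tau m k)) (act Y (X k))"
      by (intro homL_act X Y hw_homL)+
    moreover have "(a + (b + tau m k)) mod 2 = ((a + b) mod 2 + tau m k) mod 2"
      "(b + (a + tau m k)) mod 2 = ((a + b) mod 2 + tau m k) mod 2" by presburger+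
    ultimately have "homL ((a + b) mod 2 + tau m k) (act X (Y k))" "homL ((a + b) mod 2 + tau m k) (act Y (X k))"
      using homL_mod by blast+
    then show ?thesis unfolding br_hom[OF X Y] by (intro homL_diff homL_sc)
  qed
  then show ?thesis by (simp add: hw_def inW_br homW_homL)
qed

text \<open>Moving \<open>X i\<close> past \<open>f\<close> costs \<open>(a + tau m i) * b\<close>;
  its \<open>tau\<close> part cancels against the sign of the Leibniz rule for
  \<open>D i\<close>.\<close>

lemma act_mul:
  assumes X: "hw a X" and f: "homL b f"
  shows "act X (f \<cdot> g) = act X f \<cdot> g + sc ((-1) ^ (a * b)) (f \<cdot> act X g)"
proof -
  have "X i \<cdot> D i (f \<cdot> g) = X i \<cdot> D i f \<cdot> g + sc ((-1) ^ (a * b)) (f \<cdot> (X i \<cdot> D i g))" for i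
  proof -
    have "X i \<cdot> f = sc ((-1) ^ ((a + tau m i) * b)) (f \<cdot> X i)" by (intro mul_comm hw_homL X f)
    moreover have "(-1::'a) ^ (tau m i * b) * (-1) ^ ((a + tau m i) * b) = (-1) ^ (a * b)"
      unfolding power_add[symmetric] by (intro minus_one_power_eqI) (simp add: algebra_simps)
    ultimately show ?thesis
      by (simp add: D_mul[OF f] mul_simps mul_assoc[symmetric])
  qed
  then show ?thesis unfolding act_def by (simp add: sum.distrib mul_sum sc_sum)
qed

text \<open>Both compositions contain the same second-order terms, by supercommutativity of the
  coefficients and \<open>D_comm\<close>; they cancel in the supercommutator. The first-order terms
  are those of the bracket.\<close>

lemma act_br:
  assumes X: "hw a X" and Y: "hw b Y"
  shows "act (br X Y) f = act X (act Y f) - sc ((-1) ^ (a * b)) (act Y (act X f))"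
proof -
  have comp: "act X (act Y f) = (\<Sum>k\<in>YY m n. act X (Y k) \<cdot> D k f)
      + (\<Sum>k\<in>YY m n. \<Sum>i\<in>YY m n. sc ((-1) ^ (a * (b + tau m k))) (Y k \<cdot> (X i \<cdot> D i (D k f))))"
    if X: "hw a X" and Y: "hw b Y" for a b X Y
  proof -
    have "act X (act Y f) = (\<Sum>k\<in>YY m n. act X (Y k \<cdot> D k f))"
      unfolding act_def[of Y] by (rule lin_sum[OF lin_act])
    also have "\<dots> = (\<Sum>k\<in>YY m n. act X (Y k) \<cdot> D k f + sc ((-1) ^ (a * (b + tau m k))) (Y k \<cdot> act X (D k f)))"
      by (intro sum.cong refl act_mul X hw_homL Y)
    also have "\<dots> = (\<Sum>k\<in>YY m n. act X (Y k) \<cdot> D k f)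
      + (\<Sum>k\<in>YY m n. \<Sum>i\<in>YY m n. sc ((-1) ^ (a * (b + tau m k))) (Y k \<cdot> (X i \<cdot> D i (D k f))))"
      unfolding act_def[of X "D _ f"] by (simp add: sum.distrib mul_sum sc_sum)
    finally show ?thesis .
  qed
  have t: "sc ((-1) ^ (a * (b + tau m k))) (Y k \<cdot> (X i \<cdot> D i (D k f))) =
     sc ((-1) ^ (a * b)) (sc ((-1) ^ (b * (a + tau m i))) (X i \<cdot> (Y k \<cdot> D k (D i f))))" for i k
  proof -
    have "Y k \<cdot> X i = sc ((-1) ^ ((b + tau m k) * (a + tau m i))) (X i \<cdot> Y k)" by (intro mul_comm hw_homL X Y)
    then have "Y k \<cdot> (X i \<cdot> D i (D k f)) = sc ((-1) ^ ((b + tau m k) * (a + tau m i)) * (-1) ^ (tau m i * tau m k))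
      (X i \<cdot> (Y k \<cdot> D k (D i f)))"
      by (simp add: mul_assoc[symmetric] mul_simps D_comm[of i k] mult.commute)
    moreover have "(-1) ^ (a * (b + tau m k)) * ((-1) ^ ((b + tau m k) * (a + tau m i)) * (-1) ^ (tau m i * tau m k)) =
       (-1::'a) ^ (a * b) * (-1) ^ (b * (a + tau m i))"
      unfolding power_add[symmetric] by (intro minus_one_power_eqI) (auto simp: algebra_simps)
    ultimately show ?thesis by simp
  qed
  have "(\<Sum>k\<in>YY m n. \<Sum>i\<in>YY m n. sc ((-1) ^ (a * (b + tau m k))) (Y k \<cdot> (X i \<cdot> D i (D k f)))) =
    sc ((-1) ^ (a * b)) (\<Sum>i\<in>YY m n. \<Sum>k\<in>YY m n. sc ((-1) ^ (b * (a + tau m i))) (X i \<cdot> (Y k \<cdot> D k (D i f))))"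
    unfolding t sc_sum by (rule sum.swap)
  moreover have "act (br X Y) f = (\<Sum>k\<in>YY m n. act X (Y k) \<cdot> D k f) - sc ((-1) ^ (a * b)) (\<Sum>k\<in>YY m n. act Y (X k) \<cdot> D k f)"
    unfolding act_def[of "br X Y"] br_hom[OF X Y] by (simp add: mul_simps sum_subtractf sc_sum)
  ultimately show ?thesis
    unfolding comp[OF X Y] comp[OF Y X] by (simp add: algebra_simps)
qed

section \<open>Skew-symmetry, Jacobi identity and bilinearity of the bracket\<close>

lemma scaleW_apply [simp]: "scaleW c X k = sc c (X k)"
  by (simp add: scaleW_def sc_def)

lemma addW_plus: "addW X Y = X + (Y :: 'a wel)"
  by (simp add: addW_def fun_eq_iff)

lemma scaleW_simps [simp]:
  fixes X Y :: "'a wel"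
  shows "scaleW c (X + Y) = scaleW c X + scaleW c Y" "scaleW c (X - Y) = scaleW c X - scaleW c Y"
    "scaleW c (- X) = - scaleW c X" "scaleW c 0 = (0 :: 'a wel)" "scaleW 0 X = 0" "scaleW 1 X = X"
    "scaleW c (scaleW d X) = scaleW (c * d) X" "scaleW (- c) X = - scaleW c X"
  by (simp_all add: scaleW_def fun_eq_iff algebra_simps)

lemma br_skew:
  assumes X: "hw a X" and Y: "hw b Y"
  shows "br X Y = scaleW (- ((-1) ^ (a * b))) (br Y X)"
proof
  fix k
  have "(-1::'a) ^ (a * b) * (-1) ^ (b * a) = 1" by (simp add: mult.commute power_add[symmetric] flip: power_mult_distrib)
  then show "br X Y k = scaleW (- ((-1) ^ (a * b))) (br Y X) k"
    by (simp add: br_hom[OF X Y] br_hom[OF Y X])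
qed

lemma br_jacobi:
  assumes X: "hw a X" and Y: "hw b Y" and Z: "hw c Z"
  shows "br X (br Y Z) = br (br X Y) Z + scaleW ((-1) ^ (a * b)) (br Y (br X Z))"
proof
  fix k
  have abc: "a = 0 \<or> a = 1" "b = 0 \<or> b = 1" "c = 0 \<or> c = 1" using X Y Z by (auto simp: hw_def)
  show "br X (br Y Z) k = (br (br X Y) Z + scaleW ((-1) ^ (a * b)) (br Y (br X Z))) k"
    unfolding plus_fun_apply scaleW_apply
      br_hom[OF X hw_br[OF Y Z]] br_hom[OF hw_br[OF X Y] Z] br_hom[OF Y hw_br[OF X Z]]
      br_hom[OF X Y] br_hom[OF Y Z] br_hom[OF X Z] act_br[OF X Y] act_br[OF Y Z] act_br[OF X Z] act_simps
    using abc by (elim disjE) (simp_all add: fun_eq_iff algebra_simps)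
qed

lemma proj_simps:
  "proj a (f + g) = proj a f + proj a (g :: 'a lam)" "proj a (sc c f) = sc c (proj a (f :: 'a lam))"
  by (auto simp: proj_def fun_eq_iff)

lemma br_add_left: "br (X + X') Y = br X Y + br X' Y"
proof -
  have "br_term i j a b (X + X') Y k z = br_term i j a b X Y k z + br_term i j a b X' Y k z" for i j a b k z
    by (simp add: br_term_def proj_simps mul_simps D_simps algebra_simps)
  then show ?thesis by (intro ext) (simp only: br_br_term plus_fun_apply sum.distrib)
qed

lemma br_add_right: "br Y (X + X') = br Y X + br Y X'"
proof -
  have "br_term i j a b Y (X + X') k z = br_term i j a b Y X k z + br_term i j a b Y X' k z" for i j a b k z
    by (simp add: br_term_def proj_simps mul_simps D_simps algebra_simps)
  then show ?thesis by (intro ext) (simp only: br_br_term plus_fun_apply sum.distrib)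
qed

lemma br_scale_left: "br (scaleW c X) Y = scaleW c (br X Y)"
proof -
  have "br_term i j a b (scaleW c X) Y k z = c * br_term i j a b X Y k z" for i j a b k z
    by (simp add: br_term_def proj_simps mul_simps D_simps algebra_simps)
  then show ?thesis by (intro ext) (simp only: br_br_term scaleW_apply sc_apply sum_distrib_left)
qed

lemma br_scale_right: "br Y (scaleW c X) = scaleW c (br Y X)"
proof -
  have "br_term i j a b Y (scaleW c X) k z = c * br_term i j a b Y X k z" for i j a b k z
    by (simp add: br_term_def proj_simps mul_simps D_simps algebra_simps)
  then show ?thesis by (intro ext) (simp only: br_br_term scaleW_apply sc_apply sum_distrib_left)
qed


section \<open>The Hamiltonian superalgebra\<close>

abbreviation ip :: "nat \<Rightarrow> nat" where "ip i \<equiv> iprime m n i"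
abbreviation sg :: "nat \<Rightarrow> 'a" where "sg i \<equiv> sigma m i"
abbreviation H :: "'a wel set" where "H \<equiv> Hset p m n tt"
abbreviation dh :: "'a lam \<Rightarrow> 'a wel" where "dh f \<equiv> DH p m n tt f"

text \<open>The relation between \<open>sg i\<close> and \<open>sg (ip i)\<close> expresses
  supersymmetry of the underlying form: alternating on even indices, symmetric on odd ones.\<close>

lemma iprime_props:
  assumes "i \<in> YY m n"
  shows ip_YY: "ip i \<in> YY m n" and ip_ip: "ip (ip i) = i" and tau_ip: "tau m (ip i) = tau m i"
    and sg_ip: "sg i = - ((-1) ^ tau m i) * sg (ip i)"
proof -
  obtain k t where k: "m = 2 * k" and t: "n = 2 * t" using even_m even_n by (auto elim!: evenE)
  have i: "1 \<le> i" "i \<le> 2 * k + 2 * t" using assms by (auto simp: YY_def k t)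
  have "ip i \<in> YY m n \<and> ip (ip i) = i \<and> tau m (ip i) = tau m i \<and> sg i = - ((-1) ^ tau m i) * sg (ip i)"
  proof -
    consider "i \<le> k" | "k < i" "i \<le> 2 * k" | "2 * k < i" "i \<le> 2 * k + t" | "2 * k + t < i" by linarith
    then show ?thesis
      using i by cases (auto simp: iprime_def YY_def tau_def Y0_def sigma_def k t Let_def)
  qed
  then show "ip i \<in> YY m n" "ip (ip i) = i" "tau m (ip i) = tau m i" "sg i = - ((-1) ^ tau m i) * sg (ip i)"
    by auto
qed

lemma sg_sq: "sg i * sg i = 1"
  by (simp add: sigma_def)

lemma finite_YY: "finite (YY m n)"
  by (simp add: YY_def)

lemma ip_sum: "(\<Sum>i\<in>YY m n. F (ip i)) = (\<Sum>i\<in>YY m n. F i)"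
  by (rule sum.reindex_bij_witness[of _ ip ip]) (simp_all add: ip_YY ip_ip)

lemma homL_proj: "homL d (proj d f)" if "d < 2"
  using that by (simp add: homL_def proj_def)

lemma proj_split: "f = proj 0 f + proj 1 (f :: 'a lam)"
  by (auto simp: proj_def fun_eq_iff)

lemma inLam_proj: "inLam p m n tt f \<Longrightarrow> inLam p m n tt (proj d f)"
  by (simp add: inLam_def proj_def)

lemma DHh_apply: "DHh p m n tt d f k = (if k \<in> YY m n then sc (sg (ip k) * (-1) ^ (tau m (ip k) * d)) (D (ip k) f) else 0)"
  by (auto simp: DHh_def fun_eq_iff)

lemma dh_add: "dh (f + g) = dh f + dh g"
  by (rule ext) (simp add: DH_def addW_plus DHh_apply proj_simps D_simps algebra_simps)

lemma dh_sc: "dh (sc c f) = scaleW c (dh f)"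
  by (rule ext) (simp add: DH_def addW_plus DHh_apply proj_simps D_simps algebra_simps)

lemma dh_0: "dh 0 = 0"
  using dh_sc[of 0 0] by simp

lemma dh_hom:
  assumes "homL d f"
  shows "dh f k = (if k \<in> YY m n then sc (sg (ip k) * (-1) ^ (tau m k * d)) (D (ip k) f) else 0)"
proof (cases "even d")
  case True
  then have "(-1 :: 'a) ^ (tau m k * d) = 1" by simp
  then show ?thesis using True proj_hom[OF assms] by (simp add: DH_def addW_plus DHh_apply D_simps)
next
  case False
  then have "(-1 :: 'a) ^ (tau m k * d) = (-1) ^ tau m k" by (simp add: minus_one_power_iff)
  moreover have "d mod 2 = 1" using False by presburger
  ultimately show ?thesis using proj_hom[OF assms] by (simp add: DH_def addW_plus DHh_apply D_simps tau_ip)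
qed

lemma inLam_D: "inLam p m n tt (D i f)"
  by (auto simp: inLam_def Dop_def)

lemma inLam_sc: "inLam p m n tt f \<Longrightarrow> inLam p m n tt (sc c f :: 'a lam)"
  by (simp add: inLam_def)

lemma inLam_add: "inLam p m n tt f \<Longrightarrow> inLam p m n tt g \<Longrightarrow> inLam p m n tt (f + g :: 'a lam)"
  by (simp add: inLam_def)

lemma inW_add: "inW X \<Longrightarrow> inW Y \<Longrightarrow> inW (X + Y)"
  by (simp add: inW_def inLam_add)

lemma hwI: "a < 2 \<Longrightarrow> inW X \<Longrightarrow> (\<And>i. homL (a + tau m i) (X i)) \<Longrightarrow> hw a X"
  unfolding hw_def using homW_homL by blast

lemma inW_dh: "inW (dh f)"
  by (auto simp: inW_def DH_def addW_plus DHh_apply intro!: inLam_add inLam_sc inLam_D) (simp add: inLam_def)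

lemma hw_dh:
  assumes "homL d f" "d < 2"
  shows "hw d (dh f)"
proof -
  have "homL (d + tau m k) (dh f k)" for k
  proof (cases "k \<in> YY m n")
    case True
    have "homL (d + tau m k) (D (ip k) f)" using homL_D[OF assms(1), of "ip k"] by (simp add: tau_ip True)
    then show ?thesis by (simp add: dh_hom[OF assms(1)] True homL_sc)
  qed (simp add: dh_hom[OF assms(1)])
  then show ?thesis by (intro hwI assms inW_dh)
qed

text \<open>\<open>act (dh f) g\<close> is the Poisson superbracket of \<open>f\<close> and
  \<open>g\<close>. Applying \<open>D l\<close> to it gives the action of \<open>dh f\<close> on
  \<open>D l g\<close> plus a sum of terms \<open>D l (dh f i) \<cdot> D i g\<close>; the latter is,
  up to sign, the action of \<open>dh g\<close> on \<open>D l f\<close>, as required by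
  \<open>br_hom\<close>.\<close>

lemma br_dh_hom:
  assumes f: "homL a f" and g: "homL b g" and ab: "a < 2" "b < 2"
  shows "br (dh f) (dh g) = dh (act (dh f) g)"
proof
  fix k
  let ?X = "dh f" and ?Y = "dh g"
  have X: "hw a ?X" and Y: "hw b ?Y" using f g ab by (simp_all add: hw_dh)
  have gg: "homL (a + b) (act ?X g)" by (rule homL_act[OF X g])
  show "br ?X ?Y k = dh (act ?X g) k"
  proof (cases "k \<in> YY m n")
    case True
    define l where "l = ip k"
    have tl: "tau m l = tau m k" using True by (simp add: l_def tau_ip)
    have Dact: "D l (act ?X g) = (\<Sum>i\<in>YY m n. D l (?X i) \<cdot> D i g) + sc ((-1) ^ (tau m l * a)) (act ?X (D l g))"
    proof -
      have "D l (?X i \<cdot> D i g) = D l (?X i) \<cdot> D i g + sc ((-1) ^ (tau m l * a)) (?X i \<cdot> D i (D l g))" for i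
      proof -
        have "(-1::'a) ^ (tau m l * (a + tau m i)) * (-1) ^ (tau m l * tau m i) = (-1) ^ (tau m l * a)"
          unfolding power_add[symmetric] by (intro minus_one_power_eqI) (simp add: algebra_simps)
        then show ?thesis by (simp add: D_mul[OF hw_homL[OF X]] D_comm[of l i] mul_simps)
      qed
      then show ?thesis unfolding act_def by (simp add: D_sum sum.distrib sc_sum)
    qed
    have swap: "D i g \<cdot> D (ip i) (D l f) = sc ((-1) ^ ((b + tau m i) * (a + tau m l + tau m i))) (D (ip i) (D l f) \<cdot> D i g)"
      if "i \<in> YY m n" for i
      using mul_comm[OF homL_D[OF g, of i] homL_D[OF homL_D[OF f, of l], of "ip i"]] that by (simp add: tau_ip)
    \<comment> \<open>Reindexing along the involution \<open>ip\<close> pairs each summand with the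
      one for \<open>f\<close>; \<open>sg_ip\<close> then supplies the sign.\<close>
    have "act ?Y (D l f) = (\<Sum>i\<in>YY m n. ?Y (ip i) \<cdot> D (ip i) (D l f))"
      unfolding act_def by (rule ip_sum[symmetric])
    also have "\<dots> = (\<Sum>i\<in>YY m n. sc (- ((-1) ^ (a * b) * (-1) ^ (tau m l * b))) (D l (?X i) \<cdot> D i g))"
    proof (rule sum.cong[OF refl])
      fix i assume i: "i \<in> YY m n"
      have "?Y (ip i) \<cdot> D (ip i) (D l f) = sc (sg i * (-1) ^ (tau m i * b) * (-1) ^ ((b + tau m i) * (a + tau m l + tau m i))) (D (ip i) (D l f) \<cdot> D i g)"
        using i by (simp add: dh_hom[OF g] ip_YY ip_ip tau_ip mul_simps swap)
      moreover have "D l (?X i) \<cdot> D i g = sc (sg (ip i) * (-1) ^ (tau m i * a) * (-1) ^ (tau m l * tau m i)) (D (ip i) (D l f) \<cdot> D i g)"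
        using i by (simp add: dh_hom[OF f] D_simps D_comm[of l "ip i"] tau_ip mul_simps)
      moreover have "sg i * (-1) ^ (tau m i * b) * (-1) ^ ((b + tau m i) * (a + tau m l + tau m i)) =
        - ((-1) ^ (a * b) * (-1) ^ (tau m l * b)) * (sg (ip i) * (-1) ^ (tau m i * a) * (-1) ^ (tau m l * tau m i))"
      proof -
        have "(-1::'a) ^ (tau m i + (tau m i * b + (b + tau m i) * (a + tau m l + tau m i))) =
          (-1) ^ (a * b + tau m l * b + (tau m i * a + tau m l * tau m i))"
          by (intro minus_one_power_eqI) (auto simp: algebra_simps)
        then show ?thesis unfolding sg_ip[OF i] by (simp add: power_add mult_ac)
      qed
      ultimately show "?Y (ip i) \<cdot> D (ip i) (D l f) = sc (- ((-1) ^ (a * b) * (-1) ^ (tau m l * b))) (D l (?X i) \<cdot> D i g)"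
        by simp
    qed
    finally have actY: "act ?Y (D l f) = sc (- ((-1) ^ (a * b) * (-1) ^ (tau m l * b))) (\<Sum>i\<in>YY m n. D l (?X i) \<cdot> D i g)"
      by (simp only: sc_sum)
    have ee: "(-1::'a) ^ (e + e) = 1" for e :: nat by (simp add: minus_one_power_iff)
    have "br ?X ?Y k = sc (sg l * (-1) ^ (tau m k * b)) (act ?X (D l g)) -
       sc ((-1) ^ (a * b)) (sc (sg l * (-1) ^ (tau m k * a)) (act ?Y (D l f)))"
      unfolding br_hom[OF X Y] dh_hom[OF f] dh_hom[OF g] using True by (simp add: act_simps l_def)
    also have "\<dots> = sc (sg l * (-1) ^ (tau m k * (a + b))) (D l (act ?X g))"
    proof -
      have 1: "(-1::'a) ^ (tau m k * (a + b)) * (-1) ^ (tau m k * a) = (-1) ^ (tau m k * b)"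
        unfolding power_add[symmetric] by (intro minus_one_power_eqI) (simp add: algebra_simps)
      have 2: "(-1) ^ (a * b) * ((-1) ^ (tau m k * a) * ((-1) ^ (a * b) * (-1) ^ (tau m k * b))) = (-1::'a) ^ (tau m k * (a + b))"
        unfolding power_add[symmetric] by (intro minus_one_power_eqI) (simp add: algebra_simps)
      show ?thesis unfolding Dact actY tl by (simp add: 1 2 mult.assoc mult.left_commute[of _ "sg l"])
    qed
    finally show ?thesis using True by (simp add: dh_hom[OF gg] l_def)
  next
    case False
    then show ?thesis by (simp add: br_outside dh_hom[OF gg])
  qed
qed

lemma br_dh: "\<exists>h. inLam p m n tt h \<and> br (dh f) (dh g) = dh h"
proof -
  let ?h = "\<lambda>a b. act (dh (proj a f)) (proj b g)"
  have 1: "br (dh (proj a f)) (dh (proj b g)) = dh (?h a b)" if "a < 2" "b < 2" for a b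
    using br_dh_hom[OF homL_proj homL_proj] that by blast
  have "br (dh f) (dh g) = br (dh (proj 0 f + proj 1 f)) (dh (proj 0 g + proj 1 g))"
    using proj_split by metis
  also have "\<dots> = dh (?h 0 0 + ?h 0 1 + (?h 1 0 + ?h 1 1))"
    by (simp add: dh_add br_add_left br_add_right 1 add_ac)
  finally show ?thesis by (intro exI conjI) (simp_all add: inLam_add inLam_act)
qed

section \<open>\<open>H\<close> as a graded subalgebra\<close>

lemma H_0: "0 \<in> H"
  unfolding Hset_def by (rule CollectI, rule exI[of _ 0]) (auto simp: fun_eq_iff)

lemma H_step:
  assumes "X \<in> H" "inLam p m n tt f" "inLam p m n tt g"
  shows "X + br (dh f) (dh g) \<in> H"
proof -
  obtain F G and N :: nat where X: "X = (\<lambda>k z. \<Sum>l<N. br (dh (F l)) (dh (G l)) k z)"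
    and FG: "\<forall>l<N. inLam p m n tt (F l) \<and> inLam p m n tt (G l)"
    using assms(1) unfolding Hset_def by auto
  let ?F = "F(N := f)" and ?G = "G(N := g)"
  have "X + br (dh f) (dh g) = (\<lambda>k z. \<Sum>l<Suc N. br (dh (?F l)) (dh (?G l)) k z)"
    by (intro ext) (simp add: X)
  moreover have "\<forall>l<Suc N. inLam p m n tt (?F l) \<and> inLam p m n tt (?G l)"
    using FG assms(2,3) by (simp add: less_Suc_eq)
  ultimately show ?thesis unfolding Hset_def by blast
qed

lemma H_induct [consumes 1, case_names zero step]:
  assumes "X \<in> H" "P 0"
    "\<And>X f g. X \<in> H \<Longrightarrow> P X \<Longrightarrow> inLam p m n tt f \<Longrightarrow> inLam p m n tt g \<Longrightarrow> P (X + br (dh f) (dh g))"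
  shows "P X"
proof -
  obtain F G and N :: nat where X: "X = (\<lambda>k z. \<Sum>l<N. br (dh (F l)) (dh (G l)) k z)"
    and FG: "\<forall>l<N. inLam p m n tt (F l) \<and> inLam p m n tt (G l)"
    using assms(1) unfolding Hset_def by auto
  have "(\<lambda>k z. \<Sum>l<N. br (dh (F l)) (dh (G l)) k z) \<in> H \<and> P (\<lambda>k z. \<Sum>l<N. br (dh (F l)) (dh (G l)) k z)"
    using FG
  proof (induction N)
    case 0
    have "(\<lambda>k z. \<Sum>l<0. br (dh (F l)) (dh (G l)) k z) = 0" by (intro ext) simp
    then show ?case using H_0 assms(2) by simp
  next
    case (Suc N)
    have "(\<lambda>k z. \<Sum>l<Suc N. br (dh (F l)) (dh (G l)) k z) =
       (\<lambda>k z. \<Sum>l<N. br (dh (F l)) (dh (G l)) k z) + br (dh (F N)) (dh (G N))"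
      by (intro ext) simp
    then show ?case using Suc assms(3) H_step by simp
  qed
  then show ?thesis using X by simp
qed

lemma H_add:
  assumes "X \<in> H" "Y \<in> H"
  shows "X + Y \<in> H"
  using assms(2)
proof (induction rule: H_induct)
  case zero
  then show ?case using assms(1) by simp
next
  case (step Y f g)
  then have "X + Y + br (dh f) (dh g) \<in> H" by (intro H_step)
  then show ?case by (simp only: add.assoc)
qed

lemma H_scale: "X \<in> H \<Longrightarrow> scaleW c X \<in> H"
proof (induction rule: H_induct)
  case zero
  then show ?case using H_0 by (simp only: scaleW_simps)
next
  case (step X f g)
  then have "scaleW c X + br (dh (sc c f)) (dh g) \<in> H" by (intro H_step inLam_sc)
  then show ?case by (simp only: scaleW_simps dh_sc br_scale_left)
qed

lemma H_dh: "X \<in> H \<Longrightarrow> \<exists>f. inLam p m n tt f \<and> X = dh f"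
proof (induction rule: H_induct)
  case zero
  then show ?case using dh_0 by (metis inLam_def zero_fun_apply)
next
  case (step X f g)
  then show ?case using br_dh[of f g] by (metis dh_add inLam_add)
qed

lemma br_dh_in_H: "inLam p m n tt f \<Longrightarrow> inLam p m n tt g \<Longrightarrow> br (dh f) (dh g) \<in> H"
  using H_step[OF H_0] by simp

lemma H_br: "X \<in> H \<Longrightarrow> Y \<in> H \<Longrightarrow> br X Y \<in> H"
  using H_dh br_dh_in_H by metis

lemma H_inW: "X \<in> H \<Longrightarrow> inW X"
  using H_dh inW_dh by metis

lemma hw_add:
  assumes "hw a X" "hw a Y"
  shows "hw a (X + Y)"
proof (rule hwI)
  show "a < 2" "inW (X + Y)" using assms by (simp_all add: hw_def inW_add)
  show "homL (a + tau m i) ((X + Y) i)" for i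
    by (simp only: plus_fun_apply) (rule homL_add; rule hw_homL; rule assms)
qed

lemma hw_scale:
  assumes "hw a X"
  shows "hw a (scaleW c X)"
proof (rule hwI)
  show "a < 2" "inW (scaleW c X)" using assms by (auto simp: hw_def inW_def inLam_sc)
  show "homL (a + tau m i) (scaleW c X i)" for i
    by (simp only: scaleW_apply) (rule homL_sc; rule hw_homL; rule assms)
qed

lemma hw_0: "a < 2 \<Longrightarrow> hw a 0"
  by (rule hwI) (simp_all add: inW_def inLam_def)

lemma hw_br_cong: "hw a X \<Longrightarrow> hw b Y \<Longrightarrow> c = (a + b) mod 2 \<Longrightarrow> hw c (br X Y)"
  using hw_br by simp

text \<open>The biderivation rules speak only of homogeneous elements. Splitting \<open>f\<close>
  and \<open>g\<close> by parity turns each generating bracket into four homogeneous brackets that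
  again lie in \<open>H\<close>.\<close>

lemma H_split: "X \<in> H \<Longrightarrow> \<exists>X0\<in>H. \<exists>X1\<in>H. hw 0 X0 \<and> hw 1 X1 \<and> X = X0 + X1"
proof (induction rule: H_induct)
  case zero
  have "0 = (0 :: 'a wel) + 0" by (rule add_0[symmetric])
  moreover have "hw 0 0" "hw 1 0" by (simp_all add: hw_0)
  ultimately show ?case using H_0 by blast
next
  case (step X f g)
  then obtain X0 X1 where X: "X0 \<in> H" "X1 \<in> H" "hw 0 X0" "hw 1 X1" "X = X0 + X1" by blast
  let ?b = "\<lambda>a b. br (dh (proj a f)) (dh (proj b g))"
  have bH: "?b a b \<in> H" for a b by (intro br_dh_in_H inLam_proj step)
  have h: "hw a (dh (proj a f))" "hw a (dh (proj a g))" if "a < 2" for a using that by (simp_all add: hw_dh homL_proj)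
  have "br (dh f) (dh g) = br (dh (proj 0 f + proj 1 f)) (dh (proj 0 g + proj 1 g))"
    using proj_split by metis
  also have "\<dots> = (?b 0 0 + ?b 1 1) + (?b 0 1 + ?b 1 0)"
    by (simp add: dh_add br_add_left br_add_right add_ac)
  finally have "X + br (dh f) (dh g) = (X0 + (?b 0 0 + ?b 1 1)) + (X1 + (?b 0 1 + ?b 1 0))"
    by (simp add: X(5) add_ac)
  moreover have "hw 0 (X0 + (?b 0 0 + ?b 1 1))" "hw 1 (X1 + (?b 0 1 + ?b 1 0))"
    by (intro hw_add X hw_br_cong[OF h(1) h(2)]; simp)+
  ultimately show ?case using X bH H_add by (meson)
qed


section \<open>Multilinear monomials and centralizers\<close>

definition msup :: "nat set \<Rightarrow> mon" where
  "msup S = (\<lambda>i. if i \<in> S \<inter> Y0 m then 1 else 0, S \<inter> Y1 m n)"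

lemma two_less: "i \<in> Y0 m \<Longrightarrow> 2 < p ^ tt i"
proof -
  assume "i \<in> Y0 m"
  then have "p ^ 1 \<le> p ^ tt i" using tt_pos[of i] p_gt_2 by (intro power_increasing) (auto simp: Y0_def)
  then show ?thesis using p_gt_2 by simp
qed

lemma msup_B: "msup S \<in> B"
proof -
  have "1 < p ^ tt i" "0 < p ^ tt i" if "i \<in> Y0 m" for i using two_less[OF that] by linarith+
  then show ?thesis unfolding B_iff by (simp add: msup_def)
qed

text \<open>The sign acquired when \<open>x_l\<close> is differentiated away from
  \<open>x_S\<close>.\<close>

definition eps :: "nat \<Rightarrow> nat set \<Rightarrow> 'a" where
  "eps l S = (if l \<in> Y0 m then 1 else (-1) ^ ninv {l} (S \<inter> Y1 m n))"

lemma eps_sq: "eps l S * eps l S = 1"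
  by (simp add: eps_def power_mult_distrib[symmetric])

lemma eps_nz: "eps l S \<noteq> 0"
  using eps_sq[of l S] by auto

lemma D_msup:
  assumes "l \<in> YY m n"
  shows "D l (xm (msup S)) = (if l \<in> S then sc (eps l S) (xm (msup (S - {l}))) else 0)"
proof (cases "l \<in> Y0 m")
  case True
  then have "l \<in> S \<Longrightarrow> dec l (msup S) = msup (S - {l})"
    using Y_disjoint by (intro mon_eqI) (auto simp: msup_def)
  then show ?thesis using True msup_B by (simp add: D_even_mono eps_def) (simp add: msup_def)
next
  case False
  then have l: "l \<in> Y1 m n" using assms by (simp add: YY_eq)
  have "l \<in> S \<Longrightarrow> del l (msup S) = msup (S - {l})"
    using False by (intro mon_eqI) (auto simp: msup_def)
  then show ?thesis using False l msup_B by (simp add: D_odd_mono eps_def) (simp add: msup_def)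
qed

abbreviation one :: "'a lam" where "one \<equiv> xm (msup {})"

lemma one_mul: "one \<cdot> f = (\<Sum>b\<in>B. sc (f b) (xm b))"
proof -
  have "one \<cdot> xm b = xm b" if "b \<in> B" for b
  proof -
    have "madd (msup {}) b = b" by (rule mon_eqI) (auto simp: msup_def)
    moreover have "mcoef m (msup {}) b = (1::'a)" by (simp add: mcoef_def msup_def sgnmon_def)
    ultimately show ?thesis using that msup_B by (simp add: mul_mono)
  qed
  then show ?thesis by (subst llin_expand[OF llin_mul_right]) (intro sum.cong refl, simp)
qed

lemma inLam_expand: "inLam p m n tt f \<Longrightarrow> (\<Sum>b\<in>B. sc (f b) (xm b)) = (f :: 'a lam)"
  by (rule ext) (auto simp: sum_apply mono1_def finite_B inLam_def if_distrib[of "(*) _"] cong: if_cong)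

lemma one_mul_D: "one \<cdot> D i f = D i f"
  using one_mul inLam_expand[OF inLam_D] by metis

lemma inLam_msup: "inLam p m n tt (xm (msup S))"
  using msup_B by (auto simp: inLam_def mono1_def)

definition par :: "nat set \<Rightarrow> nat" where "par S = card (S \<inter> Y1 m n) mod 2"

lemma par_less: "par S < 2" by (simp add: par_def)

lemma homL_msup: "homL (par S) (xm (msup S))"
  by (auto simp: homL_def mono1_def msup_def par_def)

definition h :: "nat set \<Rightarrow> 'a wel" where "h S = dh (xm (msup S))"

lemma hw_h: "hw (par S) (h S)"
  unfolding h_def by (intro hw_dh homL_msup par_less)

text \<open>\<open>E l\<close> is the derivation \<open>D_l\<close>; the unit in front of \<open>D_H(x_{l'})\<close> is its own inverse.\<close>

definition E :: "nat \<Rightarrow> 'a wel" where "E l = scaleW (sg (ip l) * (-1) ^ tau m l) (h {ip l})"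

lemma E_dh: "E l = dh (sc (sg (ip l) * (-1) ^ tau m l) (xm (msup {ip l})))"
  by (simp add: E_def h_def dh_sc)

lemma par_single: "i \<in> YY m n \<Longrightarrow> par {i} = tau m i"
proof -
  assume i: "i \<in> YY m n"
  show "par {i} = tau m i"
  proof (cases "i \<in> Y0 m")
    case True
    then have "{i} \<inter> Y1 m n = {}" using Y_disjoint by auto
    then show ?thesis using True by (simp add: par_def tau_even)
  next
    case False
    then show ?thesis using i by (simp add: par_def YY_eq tau_odd)
  qed
qed

lemma eps_single: "eps i {i} = 1"
proof -
  have "ninv {i} {i} = 0" by (simp add: ninv_singleton_left)
  moreover have "ninv {i} {} = 0" by (simp add: ninv_singleton_left)
  ultimately show ?thesis by (cases "i \<in> Y1 m n") (simp_all add: eps_def)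
qed

lemma E_apply:
  assumes "l \<in> YY m n"
  shows "E l k = (if k = l then one else 0)"
proof (cases "k \<in> YY m n")
  case True
  have "ip k = ip l \<longleftrightarrow> k = l" using ip_ip True assms by metis
  moreover have "(-1::'a) ^ tau m l * (-1) ^ (tau m l * tau m l) = 1" by (simp add: tau_def)
  ultimately show ?thesis
    using True assms sg_sq[of "ip l"]
    by (simp add: E_def h_def dh_hom[OF homL_msup] D_msup ip_YY par_single tau_ip eps_single mult_ac)
next
  case False
  then show ?thesis using assms by (auto simp: E_def h_def dh_hom[OF homL_msup])
qed

lemma hw_E: "l \<in> YY m n \<Longrightarrow> hw (tau m l) (E l)"
  unfolding E_def using hw_h[of "{ip l}"] by (intro hw_scale) (simp add: par_single ip_YY tau_ip)

lemma act_E: "l \<in> YY m n \<Longrightarrow> act (E l) f = D l f"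
proof -
  assume l: "l \<in> YY m n"
  have "act (E l) f = (\<Sum>i\<in>YY m n. if i = l then D l f else 0)"
    unfolding act_def by (intro sum.cong refl) (simp add: E_apply[OF l] one_mul_D mul_simps)
  then show ?thesis using l finite_YY by simp
qed

lemma br_E_dh:
  assumes l: "l \<in> YY m n"
  shows "br (E l) (dh g) = dh (D l g)"
proof -
  have hom: "br (E l) (dh (proj b g)) = dh (D l (proj b g))" if "b < 2" for b
  proof -
    have "homL (tau m l) (sc (sg (ip l) * (-1) ^ tau m l) (xm (msup {ip l})))"
      using homL_msup[of "{ip l}"] l by (intro homL_sc) (simp add: par_single ip_YY tau_ip)
    moreover have "tau m l < 2" by (simp add: tau_def)
    ultimately show ?thesis
      using br_dh_hom[OF _ homL_proj[OF that] _ that] act_E[OF l] unfolding E_dh by metis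
  qed
  have "br (E l) (dh (proj 0 g + proj 1 g)) = dh (D l (proj 0 g + proj 1 g))"
    by (simp add: dh_add br_add_right hom D_simps)
  then show ?thesis using proj_split[of g] by metis
qed

text \<open>This is how membership in \<open>H\<close> is obtained: \<open>dh (D l g)\<close> is the
  bracket of \<open>E l\<close> and \<open>dh g\<close>.\<close>

lemma dh_D_in_H:
  assumes "l \<in> YY m n" "inLam p m n tt g"
  shows "dh (D l g) \<in> H"
  using br_dh_in_H[OF inLam_sc[OF inLam_msup] assms(2)] br_E_dh[OF assms(1)] unfolding E_dh by metis

lemma h_in_H:
  assumes "S \<subseteq> YY m n"
  shows "h S \<in> H"
proof (cases "S = YY m n")
  case False
  then obtain s where s: "s \<in> YY m n" "s \<notin> S" using assms by auto
  then have "xm (msup S) = sc (eps s (insert s S)) (D s (xm (msup (insert s S))))"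
    using eps_sq[of s "insert s S"] by (simp add: D_msup)
  then have "h S = scaleW (eps s (insert s S)) (dh (D s (xm (msup (insert s S)))))"
    by (simp add: h_def dh_sc)
  then show ?thesis using s by (simp add: H_scale dh_D_in_H inLam_msup)
next
  case True
  \<comment> \<open>The top multilinear monomial is still a derivative, of the one with \<open>x_1\<close> replaced by its divided
    square, as \<open>p > 2\<close>.\<close>
  define b where "b = ((fst (msup S))(1 := 2), snd (msup S))"
  have 1: "1 \<in> Y0 m" "1 \<in> YY m n" using m_ge by (auto simp: Y0_def YY_def)
  have b: "b \<in> B" using msup_B[of S] 1 two_less by (auto simp: B_iff b_def)
  have "dec 1 b = msup S" using True 1 by (intro mon_eqI) (auto simp: b_def msup_def)
  then have "xm (msup S) = D 1 (xm b)" using D_even_mono[OF b 1(1)] by (simp add: b_def)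
  then show ?thesis using dh_D_in_H[OF 1(2), of "xm b"] b by (auto simp: h_def inLam_def mono1_def)
qed

lemma E_in_H: "l \<in> YY m n \<Longrightarrow> E l \<in> H"
  unfolding E_def by (intro H_scale h_in_H) (simp add: ip_YY)

lemma br_E_h:
  assumes "l \<in> YY m n"
  shows "br (E l) (h S) = (if l \<in> S then scaleW (eps l S) (h (S - {l})) else 0)"
  unfolding h_def using br_E_dh[OF assms] D_msup[OF assms] by (simp add: dh_sc dh_0)

lemma dh_eq_0D:
  assumes "dh f = 0" "homL d f" "l \<in> YY m n"
  shows "D l f = 0"
proof -
  have "sc (sg l * (-1) ^ (tau m (ip l) * d)) (D l f) = 0"
    using dh_hom[OF assms(2), of "ip l"] assms(1,3) by (simp add: ip_YY ip_ip)
  moreover have "sg l * (-1) ^ (tau m (ip l) * d) \<noteq> 0" using sg_sq[of l] by auto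
  ultimately show ?thesis by (auto simp: fun_eq_iff)
qed

section \<open>Nonvanishing, constants and centralizers\<close>

lemma sc_mono1_eq_0: "sc c (xm b) = 0 \<longleftrightarrow> c = (0::'a)"
proof
  assume "sc c (xm b) = 0"
  then have "sc c (xm b) b = 0" by (metis zero_fun_apply)
  then show "c = 0" by (simp add: mono1_def)
qed simp

lemma h_nz:
  assumes "S \<subseteq> YY m n" "S \<noteq> {}"
  shows "h S \<noteq> 0"
proof
  assume "h S = 0"
  moreover obtain l where "l \<in> S" "l \<in> YY m n" using assms by auto
  ultimately show False
    using dh_eq_0D[OF _ homL_msup, of S l] D_msup[of l S] sc_mono1_eq_0 eps_nz unfolding h_def by metis
qed

lemma h_empty: "h {} = 0"
  by (rule ext) (simp add: h_def dh_hom[OF homL_msup] D_msup ip_YY)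

text \<open>For a monomial \<open>b\<close> other than 1, lower one of its variables: the
  corresponding derivative of \<open>f\<close> has coefficient \<open>f b\<close>, up to sign, at
  the lowered monomial.\<close>

lemma D_all_0:
  assumes "inLam p m n tt f" "\<And>l. l \<in> YY m n \<Longrightarrow> D l f = 0"
  shows "f = sc (f (msup {})) one"
proof
  fix b :: mon
  have nz: "f b = 0" if b: "b \<in> B" and ne: "b \<noteq> msup {}" for b
  proof -
    have "(\<exists>i\<in>Y0 m. fst b i \<noteq> 0) \<or> (\<exists>i\<in>Y1 m n. i \<in> snd b)"
    proof (rule ccontr)
      assume c: "\<not> ?thesis"
      then have "fst b i = fst (msup {}) i" for i using b by (auto simp: B_iff msup_def)
      moreover have "snd b = snd (msup {})" using b c by (auto simp: B_iff msup_def)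
      ultimately show False using ne mon_eqI by blast
    qed
    then show ?thesis
    proof (elim disjE bexE)
      fix i assume i: "i \<in> Y0 m" "fst b i \<noteq> 0"
      have "((fst (dec i b))(i := fst (dec i b) i + 1), snd (dec i b)) = b"
        using i by (intro mon_eqI) auto
      then have "D i f (dec i b) = f b" using i b dec_B[OF b, of i] by (simp add: Dop_def dec_def)
      then show ?thesis using assms(2)[of i] i by (simp add: YY_eq)
    next
      fix i assume i: "i \<in> Y1 m n" "i \<in> snd b"
      have "(fst (del i b), insert i (snd (del i b))) = b"
        using i by (intro mon_eqI) auto
      then have "D i f (del i b) = (-1) ^ card {j \<in> snd (del i b). j < i} * f b"
        using i b del_B[OF b, of i] Y_disjoint by (auto simp: Dop_def del_def)
      then show ?thesis using assms(2)[of i] i by (simp add: YY_eq)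
    qed
  qed
  have "b \<notin> B \<Longrightarrow> f b = 0" using assms(1) unfolding inLam_def by blast
  then have "b \<noteq> msup {} \<Longrightarrow> f b = 0" using nz by blast
  then show "f b = sc (f (msup {})) one b" by (cases "b = msup {}") (simp_all add: mono1_def)
qed

lemma br_0_left: "br 0 X = 0"
  using br_scale_left[of 0 0 X] by simp

lemma br_sum_left: "br (\<Sum>i\<in>I. F i) X = (\<Sum>i\<in>I. br (F i) X)"
  by (induction I rule: infinite_finite_induct) (simp_all only: sum.infinite sum.empty sum.insert not_False_eq_True br_0_left br_add_left)

text \<open>\<open>w\<close> kills the constant coefficients of \<open>E l\<close>, so the bracket
  with \<open>E l\<close> just differentiates each coefficient of \<open>w\<close>.\<close>

lemma constant_coeffs:
  assumes w: "hw d w" and c: "\<And>l. l \<in> YY m n \<Longrightarrow> br (E l) w = 0"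
  shows "w = (\<Sum>k\<in>YY m n. scaleW (w k (msup {})) (E k))"
proof -
  have "D l (w k) = 0" if l: "l \<in> YY m n" for k l
  proof -
    have "act w (E l k) = 0"
      using l by (simp add: E_apply act_simps) (simp add: act_def D_msup mul_simps)
    then have "D l (w k) = br (E l) w k"
      using br_hom[OF hw_E[OF l] w, of k] act_E[OF l] by simp
    then show ?thesis using c[OF l] by simp
  qed
  then have k: "w k = sc (w k (msup {})) one" for k
    using w by (intro D_all_0) (auto simp: hw_def inW_def)
  show ?thesis
  proof
    fix j
    show "w j = (\<Sum>k\<in>YY m n. scaleW (w k (msup {})) (E k)) j"
    proof (cases "j \<in> YY m n")
      case True
      have "(\<Sum>k\<in>YY m n. scaleW (w k (msup {})) (E k)) j = (\<Sum>k\<in>YY m n. if k = j then sc (w j (msup {})) one else 0)"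
        by (rule trans[OF sum_apply], intro sum.cong refl) (simp add: E_apply)
      then show ?thesis using True finite_YY k[of j] by simp
    next
      case False
      then have "scaleW (w k (msup {})) (E k) j = 0" if "k \<in> YY m n" for k
        using that by (auto simp: E_apply)
      then have "(\<Sum>k\<in>YY m n. scaleW (w k (msup {})) (E k)) j = 0" by (intro trans[OF sum_apply] sum.neutral ballI)
      then show ?thesis using w False by (simp add: hw_def inW_def)
    qed
  qed
qed

text \<open>Only \<open>k = j\<close> and \<open>k = l\<close> contribute, giving multiples of
  \<open>h {l}\<close> and \<open>h {j}\<close>. These point in the distinct directions
  \<open>ip l\<close> and \<open>ip j\<close>, so the component at \<open>ip l\<close> isolates
  \<open>a j\<close>.\<close>

lemma E_combination_pair:
  assumes "br (\<Sum>k\<in>YY m n. scaleW (a k) (E k)) (h {j, l}) = 0"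
    and j: "j \<in> YY m n" and l: "l \<in> YY m n" "l \<noteq> j"
  shows "a j = 0"
proof -
  have "0 = br (\<Sum>k\<in>YY m n. scaleW (a k) (E k)) (h {j, l})"
    using assms(1) by simp
  also have "\<dots> = (\<Sum>k\<in>YY m n. scaleW (a k) (br (E k) (h {j, l})))"
    by (simp add: br_sum_left br_scale_left)
  also have "\<dots> = (\<Sum>k\<in>YY m n. (if k = j then scaleW (a j * eps j {j, l}) (h {l}) else 0)
      + (if k = l then scaleW (a l * eps l {j, l}) (h {j}) else 0))"
  proof (intro sum.cong refl)
    have "{j, l} - {j} = {l}" "{j, l} - {l} = {j}" using l by auto
    then show "scaleW (a k) (br (E k) (h {j, l})) = (if k = j then scaleW (a j * eps j {j, l}) (h {l}) else 0)
      + (if k = l then scaleW (a l * eps l {j, l}) (h {j}) else 0)" if "k \<in> YY m n" for k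
      using that l by (auto simp: br_E_h)
  qed
  also have "\<dots> = scaleW (a j * eps j {j, l}) (h {l}) + scaleW (a l * eps l {j, l}) (h {j})"
    using j l finite_YY by (simp add: sum.distrib)
  finally have z: "scaleW (a j * eps j {j, l}) (h {l}) + scaleW (a l * eps l {j, l}) (h {j}) = 0" by simp
  have "h {l} (ip l) \<noteq> 0 \<and> h {j} (ip l) = 0"
    using l j sc_mono1_eq_0[of 1] sg_sq[of l] sc_mono1_eq_0[of "sg l * (-1) ^ (tau m l * par {l})" "msup {}"]
    by (auto simp: h_def dh_hom[OF homL_msup] D_msup ip_YY ip_ip tau_ip eps_single)
  moreover have "(scaleW (a j * eps j {j, l}) (h {l}) + scaleW (a l * eps l {j, l}) (h {j})) (ip l) = 0"
    using z by simp
  ultimately have "sc (a j * eps j {j, l}) (h {l} (ip l)) = 0" "h {l} (ip l) \<noteq> 0" by simp_all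
  then show ?thesis using eps_nz by (auto simp: fun_eq_iff)
qed

text \<open>Singletons \<open>S\<close> give commutation with every \<open>E l\<close>, hence
  constant coefficients; pairs then kill these constants one by one.\<close>

lemma centralizer_0:
  assumes w: "hw d w"
    and c: "\<And>S. S \<subseteq> YY m n \<Longrightarrow> card S = 1 \<or> card S = 2 \<Longrightarrow> br w (h S) = 0"
  shows "w = 0"
proof -
  have "br (E l) w = 0" if l: "l \<in> YY m n" for l
  proof -
    have "br w (E l) = 0" unfolding E_def using c[of "{ip l}"] ip_YY[OF l] by (simp add: br_scale_right)
    then show ?thesis using br_skew[OF hw_E[OF l] w] by simp
  qed
  note we = constant_coeffs[OF w this]
  define a where "a k = w k (msup {})" for k
  have "a j = 0" if j: "j \<in> YY m n" for j
  proof -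
    have "\<exists>l\<in>YY m n. l \<noteq> j" using m_ge by (intro bexI[of _ "if j = 1 then 2 else 1"]) (auto simp: YY_def)
    then obtain l where l: "l \<in> YY m n" "l \<noteq> j" by blast
    have "br w (h {j, l}) = 0" using c[of "{j, l}"] j l by simp
    then show ?thesis using E_combination_pair[OF _ j l, of a] we unfolding a_def by simp
  qed
  then show ?thesis using we by (simp add: a_def)
qed

end

section \<open>Skew-symmetric super-biderivations\<close>

locale hamiltonian_biderivation = hamiltonian p m n tt ty
  for p m n :: nat and tt :: "nat \<Rightarrow> nat" and ty :: "'a::field itself" +
  fixes d :: nat and phi :: "'a wel \<Rightarrow> 'a wel \<Rightarrow> 'a wel"
  assumes biderivation: "skew_super_biderivation (Hset p m n tt) (brW p m n tt) (homW m) d phi"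
begin

definition hh :: "nat \<Rightarrow> 'a wel \<Rightarrow> bool" where "hh a X \<longleftrightarrow> X \<in> H \<and> hw a X"

lemma hhD: "hh a X \<Longrightarrow> X \<in> H" "hh a X \<Longrightarrow> hw a X" "hh a X \<Longrightarrow> a < 2" "hh a X \<Longrightarrow> homW m a X"
  by (auto simp: hh_def hw_def)

lemma hh_cases: "hh a X \<Longrightarrow> a = 0 \<or> a = 1"
  using hhD(3) by fastforce

lemma d_less: "d < 2"
  using biderivation by (simp add: skew_super_biderivation_def)

lemma d_cases: "d = 0 \<or> d = 1"
  using d_less by auto

lemma phi_H: "x \<in> H \<Longrightarrow> y \<in> H \<Longrightarrow> phi x y \<in> H"
  using biderivation unfolding skew_super_biderivation_def by blast

lemma
  assumes "x \<in> H" "y \<in> H" "z \<in> H"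
  shows phi_add_left: "phi (x + y) z = phi x z + phi y z"
    and phi_add_right: "phi z (x + y) = phi z x + phi z y"
  using biderivation assms unfolding skew_super_biderivation_def addW_plus by blast+

lemma phi_scale_right: "x \<in> H \<Longrightarrow> z \<in> H \<Longrightarrow> phi z (scaleW c x) = scaleW c (phi z x)"
  using biderivation unfolding skew_super_biderivation_def by blast

lemma hh_phi: "hh a x \<Longrightarrow> hh b y \<Longrightarrow> hh ((a + b + d) mod 2) (phi x y)"
proof -
  assume "hh a x" "hh b y"
  moreover from this have "homW m ((a + b + d) mod 2) (phi x y)"
    using biderivation hhD unfolding skew_super_biderivation_def by meson
  ultimately show ?thesis by (simp add: hh_def hw_def phi_H H_inW)
qed

lemma hh_br: "hh a x \<Longrightarrow> hh b y \<Longrightarrow> hh ((a + b) mod 2) (br x y)"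
  by (simp add: hh_def H_br hw_br)

lemma phi_br_right:
  assumes "hh a x" "hh b y" "hh c z"
  shows "phi x (br y z) = br (phi x y) z + scaleW ((-1) ^ ((d + a) * b)) (br y (phi x z))"
proof -
  have "\<forall>a b c x y z. a < 2 \<longrightarrow> b < 2 \<longrightarrow> c < 2 \<longrightarrow> x \<in> H \<longrightarrow> y \<in> H \<longrightarrow> z \<in> H \<longrightarrow>
        homW m a x \<longrightarrow> homW m b y \<longrightarrow> homW m c z \<longrightarrow>
        phi x (br y z) = br (phi x y) z + scaleW ((-1) ^ ((d + a) * b)) (br y (phi x z))"
    using biderivation unfolding skew_super_biderivation_def addW_plus by blast
  then show ?thesis using assms hhD by meson
qed

lemma phi_skew:
  assumes "hh a x" "hh b y"
  shows "phi x y = scaleW (- ((-1) ^ (d * a + d * b + a * b))) (phi y x)"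
proof -
  have "\<forall>a b x y. a < 2 \<longrightarrow> b < 2 \<longrightarrow> x \<in> H \<longrightarrow> y \<in> H \<longrightarrow> homW m a x \<longrightarrow> homW m b y \<longrightarrow>
        phi x y = scaleW (- ((-1) ^ (d * a + d * b + a * b))) (phi y x)"
    using biderivation unfolding skew_super_biderivation_def by blast
  then show ?thesis using assms hhD by meson
qed

lemma br_skew': "hh a x \<Longrightarrow> hh b y \<Longrightarrow> br x y = scaleW (- ((-1) ^ (a * b))) (br y x)"
  using br_skew hhD by blast

lemma br_jacobi': "hh a x \<Longrightarrow> hh b y \<Longrightarrow> hh c z \<Longrightarrow>
  br x (br y z) = br (br x y) z + scaleW ((-1) ^ (a * b)) (br y (br x z))"
  using br_jacobi hhD by blast

lemma br_minus: "br (- x) y = - br x y" "br x (- y) = - br x y"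
  using br_scale_left[of "-1" x y] br_scale_right[of x "-1" y] by simp_all

lemma br_br_left:
  assumes X: "hh a x" and Y: "hh b y" and Z: "hh c z"
  shows "br (br x y) z = br x (br y z) + scaleW ((-1) ^ (b * c)) (br (br x z) y)"
proof -
  have "br x (br y z) = br (br x y) z + scaleW ((-1) ^ (a * b)) (br y (br x z))"
    by (rule br_jacobi'[OF X Y Z])
  moreover have "br y (br x z) = scaleW (- ((-1) ^ (b * ((a + c) mod 2)))) (br (br x z) y)"
    by (rule br_skew'[OF Y hh_br[OF X Z]])
  ultimately show ?thesis
    using hh_cases[OF X] hh_cases[OF Y] hh_cases[OF Z] by (elim disjE) simp_all
qed

lemma br_swap_both:
  assumes T: "hh t z" and Y: "hh b y" and U: "hh u w"
  shows "br z (br y w) = scaleW ((-1) ^ (b * u + t * (b + u))) (br (br w y) z)"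
proof -
  have "br z (br y w) = scaleW (- ((-1) ^ (t * ((b + u) mod 2)))) (br (br y w) z)"
    by (rule br_skew'[OF T hh_br[OF Y U]])
  moreover have "br y w = scaleW (- ((-1) ^ (b * u))) (br w y)" by (rule br_skew'[OF Y U])
  ultimately show ?thesis
    using hh_cases[OF T] hh_cases[OF Y] hh_cases[OF U]
    by (elim disjE) (simp_all add: br_minus)
qed

text \<open>Skew-symmetry transfers the derivation rule to the first argument. The signs follow the
  Koszul rule with \<open>phi\<close> as a symbol of degree \<open>d\<close> written between its
  arguments: here \<open>u\<close> passes \<open>phi\<close> and \<open>y\<close>. The signs in
  \<open>defect\<close> and its two exchange laws obey the same rule.\<close>

lemma phi_br_left:
  assumes X: "hh a x" and U: "hh b u" and Y: "hh c y"
  shows "phi (br x u) y = scaleW ((-1) ^ (b * c + d * b)) (br (phi x y) u) + br x (phi u y)"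
proof -
  have 1: "phi (br x u) y = scaleW (- ((-1) ^ (d * ((a + b) mod 2) + d * c + ((a + b) mod 2) * c))) (phi y (br x u))"
    by (rule phi_skew[OF hh_br[OF X U] Y])
  have 2: "phi y (br x u) = br (phi y x) u + scaleW ((-1) ^ ((d + c) * a)) (br x (phi y u))"
    by (rule phi_br_right[OF Y X U])
  have 3: "phi y x = scaleW (- ((-1) ^ (d * c + d * a + c * a))) (phi x y)" by (rule phi_skew[OF Y X])
  have 4: "phi y u = scaleW (- ((-1) ^ (d * c + d * b + c * b))) (phi u y)" by (rule phi_skew[OF Y U])
  show ?thesis unfolding 1 2 unfolding 3 4
    using hh_cases[OF X] hh_cases[OF Y] hh_cases[OF U] d_cases
    by (elim disjE) (simp_all add: br_minus)
qed

text \<open>In \<open>defect b c x y u v\<close>, the numbers \<open>b\<close> and \<open>c\<close> stand for the parities of \<open>y\<close> and \<open>u\<close>.\<close>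

definition defect :: "nat \<Rightarrow> nat \<Rightarrow> 'a wel \<Rightarrow> 'a wel \<Rightarrow> 'a wel \<Rightarrow> 'a wel \<Rightarrow> 'a wel" where
  "defect b c x y u v = br (phi x y) (br u v) - scaleW ((-1) ^ (d * (c + b))) (br (br x y) (phi u v))"

lemma defect_swap_12:
  assumes X: "hh a x" and Y: "hh b y" and U: "hh c u" and V: "hh e v"
  shows "defect b c x y u v = scaleW (- ((-1) ^ (d * (a + b) + a * b))) (defect a c y x u v)"
  unfolding defect_def phi_skew[OF X Y] br_skew'[OF X Y]
  using hh_cases[OF X] hh_cases[OF Y] hh_cases[OF U] d_cases
  by (elim disjE) (simp_all add: br_minus)

text \<open>\<open>eq\<close> is one coefficient of the two expansions of
  \<open>phi([x,u],[y,v])\<close> after Jacobi, with \<open>g\<close> for \<open>d\<close>. Unprimed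
  letters are the four terms of the two defects; primed letters are the remaining nested brackets,
  which cancel. Both differences agree up to the unit \<open>(-1) ^ (c * (b + g))\<close>, for every
  choice of parities.\<close>

lemma swap_13_identity:
  fixes P P' Q Q' R R' T T' :: 'a
  assumes par: "a = 0 \<or> a = 1" "b = 0 \<or> b = 1" "c = 0 \<or> c = 1" "e = 0 \<or> e = 1" "g = 0 \<or> g = (1::nat)"
    and eq: "(-1) ^ (c * b + g * c) * (P + (-1) ^ (c * e) * P') + R'
     + (-1) ^ ((g + (a + c) mod 2) * b) * ((-1) ^ (c * e + g * c) *
         (T' + (-1) ^ (b * ((a + e + g) mod 2)) * ((-1) ^ (b * c + ((a + e + g) mod 2) * (b + c)) * T)) + Q') =
     (-1) ^ (c * ((b + e) mod 2) + g * c) * (P' + (-1) ^ ((g + a) * b) * T')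
     + (R' + (-1) ^ (a * ((c + b + g) mod 2)) * R + (-1) ^ ((g + c) * b) * (Q + (-1) ^ (a * b) * Q'))"
  shows "P - (-1) ^ (g * (c + b)) * Q = (-1) ^ (c * (b + g) + a * (c + b + g)) * (R - (-1) ^ (g * (a + b)) * T)"
proof -
  have "(P - (-1) ^ (g * (c + b)) * Q) - (-1) ^ (c * (b + g) + a * (c + b + g)) * (R - (-1) ^ (g * (a + b)) * T) =
    (-1) ^ (c * (b + g)) *
    (((-1) ^ (c * b + g * c) * (P + (-1) ^ (c * e) * P') + R'
     + (-1) ^ ((g + (a + c) mod 2) * b) * ((-1) ^ (c * e + g * c) *
         (T' + (-1) ^ (b * ((a + e + g) mod 2)) * ((-1) ^ (b * c + ((a + e + g) mod 2) * (b + c)) * T)) + Q')) -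
     ((-1) ^ (c * ((b + e) mod 2) + g * c) * (P' + (-1) ^ ((g + a) * b) * T')
     + (R' + (-1) ^ (a * ((c + b + g) mod 2)) * R + (-1) ^ ((g + c) * b) * (Q + (-1) ^ (a * b) * Q'))))"
    using par by (elim disjE; hypsubst; simp add: algebra_simps)
  then show ?thesis unfolding eq by simp
qed

lemma defect_swap_13:
  assumes X: "hh a x" and Y: "hh b y" and U: "hh c u" and V: "hh e v"
  shows "defect b c x y u v = scaleW ((-1) ^ (c * (b + d) + a * (c + b + d))) (defect b a u y x v)"
proof -
  let ?P = "phi x y" and ?Q = "phi u v" and ?R = "phi u y" and ?T = "phi x v"
  note P = hh_phi[OF X Y] and Q = hh_phi[OF U V] and R = hh_phi[OF U Y] and T = hh_phi[OF X V]
  \<comment> \<open>\<open>way1\<close> opens the second argument first, \<open>way2\<close> the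
    first argument first. The Jacobi identities below bring both to the same eight brackets.\<close>
  have way1: "phi (br x u) (br y v) = scaleW ((-1) ^ (c * b + d * c)) (br (br ?P u) v) + br (br x ?R) v
     + scaleW ((-1) ^ ((d + (a + c) mod 2) * b)) (scaleW ((-1) ^ (c * e + d * c)) (br y (br ?T u)) + br y (br x ?Q))"
    unfolding phi_br_right[OF hh_br[OF X U] Y V] phi_br_left[OF X U Y] phi_br_left[OF X U V]
    by (simp add: br_add_left br_add_right br_scale_left br_scale_right)
  have way2: "phi (br x u) (br y v) = scaleW ((-1) ^ (c * ((b + e) mod 2) + d * c))
       (br (br ?P v) u + scaleW ((-1) ^ ((d + a) * b)) (br (br y ?T) u))
     + (br x (br ?R v) + scaleW ((-1) ^ ((d + c) * b)) (br x (br y ?Q)))"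
    unfolding phi_br_left[OF X U hh_br[OF Y V]] phi_br_right[OF X Y V] phi_br_right[OF U Y V]
    by (simp add: br_add_left br_add_right br_scale_left br_scale_right)
  have JP: "br (br ?P u) v = br ?P (br u v) + scaleW ((-1) ^ (c * e)) (br (br ?P v) u)"
    by (rule br_br_left[OF P U V])
  have JQ: "br x (br y ?Q) = br (br x y) ?Q + scaleW ((-1) ^ (a * b)) (br y (br x ?Q))"
    by (rule br_jacobi'[OF X Y Q])
  have JR: "br x (br ?R v) = br (br x ?R) v + scaleW ((-1) ^ (a * ((c + b + d) mod 2))) (br ?R (br x v))"
    by (rule br_jacobi'[OF X R V])
  have JT: "br y (br ?T u) = br (br y ?T) u + scaleW ((-1) ^ (b * ((a + e + d) mod 2))) (br ?T (br y u))"
    by (rule br_jacobi'[OF Y T U])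
  have JT': "br ?T (br y u) = scaleW ((-1) ^ (b * c + ((a + e + d) mod 2) * (b + c))) (br (br u y) ?T)"
    by (rule br_swap_both[OF T Y U])
  note eq = trans[OF way1[symmetric] way2, unfolded JP JQ JR JT JT']
  show ?thesis unfolding defect_def
  proof (intro ext)
    fix k z
    note eq' = fun_cong[OF fun_cong[OF eq, of k], of z]
    show "(br ?P (br u v) - scaleW ((-1) ^ (d * (c + b))) (br (br x y) ?Q)) k z =
      scaleW ((-1) ^ (c * (b + d) + a * (c + b + d)))
        (br ?R (br x v) - scaleW ((-1) ^ (d * (a + b))) (br (br u y) ?T)) k z"
      using swap_13_identity[OF hh_cases[OF X] hh_cases[OF Y] hh_cases[OF U] hh_cases[OF V] d_cases
        eq'[simplified plus_fun_apply scaleW_apply sc_apply]]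
      by (simp add: right_diff_distrib mult.assoc)
  qed
qed

lemma two_nz: "(2::'a) \<noteq> 0"
proof
  assume "(2::'a) = 0"
  then have "of_nat 2 = (0::'a)" by simp
  then have "p dvd 2" using char_p by (simp only: of_nat_eq_0_iff_char_dvd)
  then show False using p_gt_2 by (auto dest: dvd_imp_le)
qed

text \<open>The exchange of \<open>y\<close> and \<open>u\<close> is both
  \<open>(12)(13)(12)\<close>, with two skew exchanges, and \<open>(13)(12)(13)\<close>, with one.
  The resulting formulas differ exactly by the sign -1.\<close>

lemma defect_0:
  assumes X: "hh a x" and Y: "hh b y" and U: "hh c u" and V: "hh e v"
  shows "defect b c x y u v = 0"
proof -
  let ?B = "defect c b x u y v"
  have 1: "defect b c x y u v = scaleW ((-1) ^ (c * b)) ?B"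
    unfolding defect_swap_12[OF X Y U V] defect_swap_13[OF Y X U V] defect_swap_12[OF U X Y V]
    using hh_cases[OF X] hh_cases[OF Y] hh_cases[OF U] d_cases by (elim disjE; hypsubst; simp)
  have 2: "defect b c x y u v = scaleW (- ((-1) ^ (c * b))) ?B"
    unfolding defect_swap_13[OF X Y U V] defect_swap_12[OF U Y X V] defect_swap_13[OF Y U X V]
    using hh_cases[OF X] hh_cases[OF Y] hh_cases[OF U] d_cases by (elim disjE; hypsubst; simp)
  show ?thesis
  proof (intro ext)
    fix k z
    have "defect b c x y u v k z + defect b c x y u v k z = 0"
      by (subst (2) 2, subst 1) simp
    then have "2 * defect b c x y u v k z = 0" by (simp only: mult_2)
    then show "defect b c x y u v k z = 0 k z" using two_nz by simp
  qed
qed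

lemma phi_br_commute:
  assumes "hh a x" "hh b y" "hh c u" "hh e v"
  shows "br (phi x y) (br u v) = scaleW ((-1) ^ (d * (c + b))) (br (br x y) (phi u v))"
  using defect_0[OF assms] by (simp add: defect_def)


section \<open>Values on the partial derivatives and the common scalar\<close>

lemma scaleW_eq_0: "scaleW c X = 0 \<longleftrightarrow> c = (0::'a) \<or> X = 0"
proof
  assume z: "scaleW c X = 0"
  have "c * X k b = 0" for k b using fun_cong[OF fun_cong[OF z, of k], of b] by simp
  then show "c = 0 \<or> X = 0" by (auto simp: fun_eq_iff)
qed auto

lemma hh_h: "S \<subseteq> YY m n \<Longrightarrow> hh (par S) (h S)"
  by (simp add: hh_def h_in_H hw_h)

lemma hh_E: "l \<in> YY m n \<Longrightarrow> hh (tau m l) (E l)"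
  by (simp add: hh_def E_in_H hw_E)

lemma fresh_index:
  assumes "finite T" "card T < 4"
  shows "\<exists>l\<in>YY m n. l \<notin> T"
proof (rule ccontr)
  assume "\<not> ?thesis"
  then have "YY m n \<subseteq> T" by auto
  then have "card (YY m n) \<le> card T" by (rule card_mono[OF assms(1)])
  then show False using assms m_ge n_ge by (simp add: YY_def)
qed

lemma h_eq_br:
  assumes "l \<in> YY m n" "l \<notin> S"
  shows "h S = scaleW (eps l (insert l S)) (br (E l) (h (insert l S)))"
  using assms eps_sq[of l "insert l S"] by (simp add: br_E_h)

lemma h_single: "q \<in> YY m n \<Longrightarrow> \<exists>e. e \<noteq> 0 \<and> h {q} = scaleW e (E (ip q))"
proof -
  assume q: "q \<in> YY m n"
  define e :: 'a where "e = sg q * (-1) ^ tau m (ip q)"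
  have "e * e = 1" unfolding e_def
    using sg_sq[of q] by (simp add: mult_ac power_mult_distrib[symmetric] flip: mult.assoc)
  moreover have "E (ip q) = scaleW e (h {q})" using q by (simp add: E_def e_def ip_ip)
  ultimately show ?thesis by (intro exI[of _ e]) auto
qed

lemma br_E_E: "i \<in> YY m n \<Longrightarrow> j \<in> YY m n \<Longrightarrow> br (E i) (E j) = 0"
  by (simp add: E_def[of j] br_scale_right br_E_h ip_YY h_empty)

text \<open>A singleton or pair \<open>S\<close> misses some index \<open>l\<close>, and
  \<open>h S\<close> is then a multiple of the bracket of \<open>E l\<close> with the monomial on
  \<open>insert l S\<close>. In this form the criterion fits the brackets delivered by
  \<open>phi_br_commute\<close>.\<close>

lemma centralizer_br_0:
  assumes w: "hh a w"
    and c: "\<And>j S. j \<in> YY m n \<Longrightarrow> S \<subseteq> YY m n \<Longrightarrow> card S \<le> 3 \<Longrightarrow> br w (br (E j) (h S)) = 0"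
  shows "w = 0"
proof (rule centralizer_0)
  show "hw a w" using w by (rule hhD)
  fix S assume S: "S \<subseteq> YY m n" "card S = 1 \<or> card S = 2"
  then obtain l where l: "l \<in> YY m n" "l \<notin> S" using fresh_index[of S] finite_subset[OF S(1) finite_YY] by auto
  have "card (insert l S) \<le> 3" using S card_insert_le_m1[of 3 S l] by auto
  then have "br w (br (E l) (h (insert l S))) = 0" using l S by (intro c) auto
  then show "br w (h S) = 0" unfolding h_eq_br[OF l] by (simp add: br_scale_right)
qed

text \<open>The partial derivatives commute, so the right-hand side of \<open>phi_br_commute\<close>
  is zero.\<close>

lemma phi_E_E:
  assumes "i \<in> YY m n" "j \<in> YY m n"
  shows "phi (E i) (E j) = 0"
proof (rule centralizer_br_0)
  show "hh ((tau m i + tau m j + d) mod 2) (phi (E i) (E j))" by (intro hh_phi hh_E assms)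
  fix l S assume "l \<in> YY m n" "S \<subseteq> YY m n"
  then show "br (phi (E i) (E j)) (br (E l) (h S)) = 0"
    using phi_br_commute[OF hh_E[OF assms(1)] hh_E[OF assms(2)] hh_E hh_h, of l S]
    by (simp add: br_E_E assms br_0_left)
qed

lemma phi_0_right: "x \<in> H \<Longrightarrow> phi x 0 = 0"
  using phi_scale_right[of x x 0] by simp

lemma phi_E_br:
  assumes i: "i \<in> YY m n" and l: "l \<in> YY m n" and y: "hh b y"
  shows "phi (E i) (br (E l) y) = scaleW ((-1) ^ ((d + tau m i) * tau m l)) (br (E l) (phi (E i) y))"
  using phi_br_right[OF hh_E[OF i] hh_E[OF l] y] by (simp add: phi_E_E i l br_0_left)

lemma br_E_br:
  assumes i: "i \<in> YY m n" and l: "l \<in> YY m n" and y: "hh b y"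
  shows "br (E i) (br (E l) y) = scaleW ((-1) ^ (tau m i * tau m l)) (br (E l) (br (E i) y))"
  using br_jacobi'[OF hh_E[OF i] hh_E[OF l] y] by (simp add: br_E_E i l br_0_left)

lemma br_zero_swap: "hh a x \<Longrightarrow> hh b y \<Longrightarrow> br x y = 0 \<Longrightarrow> br y x = 0"
  using br_skew'[of b y a x] by simp

text \<open>If \<open>phi\<close> is \<open>c\<close> times the bracket on one pair, then \<open>phi - c [-,-]\<close> centralizes the bracket of
  that pair. An odd \<open>phi\<close> forces \<open>c = 0\<close>, which absorbs the signs.\<close>

lemma
  assumes x: "hh a x" and y: "hh b y" and c: "d = 1 \<Longrightarrow> c = 0"
  shows hh_deviation: "hh ((a + b + d) mod 2) (phi x y - scaleW c (br x y))"
    and br_deviation: "hh e u \<Longrightarrow> hh f v \<Longrightarrow> phi u v = scaleW c (br u v) \<Longrightarrow>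
      br (phi x y - scaleW c (br x y)) (br u v) = 0"
proof -
  have e: "phi x y - scaleW c (br x y) = phi x y + scaleW (- c) (br x y)" by simp
  show "hh ((a + b + d) mod 2) (phi x y - scaleW c (br x y))"
  proof (cases "d = 0")
    case True
    then show ?thesis unfolding e using hh_phi[OF x y] hh_br[OF x y]
      by (simp only: hh_def add_0_right H_add H_scale hw_add hw_scale)
  next
    case False
    then show ?thesis using hh_phi[OF x y] c d_cases by simp
  qed
  assume u: "hh e u" and v: "hh f v" and uv: "phi u v = scaleW c (br u v)"
  have "br (phi x y) (br u v) = scaleW c (br (br x y) (br u v))"
    unfolding phi_br_commute[OF x y u v] uv using c d_cases by (auto simp: br_scale_right)
  then show "br (phi x y - scaleW c (br x y)) (br u v) = 0"
    unfolding e br_add_left br_scale_left by simp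
qed

lemma hw_scaled_E:
  assumes "hw b (scaleW e (E l))" "e \<noteq> 0" "l \<in> YY m n"
  shows "b = tau m l"
proof -
  have "scaleW e (E l) l (msup {}) \<noteq> 0" using assms by (simp add: E_apply mono1_def)
  then have "(card (snd (msup {})) + tau m l) mod 2 = b" using assms(1) unfolding hw_def homW_def by blast
  then show ?thesis by (simp add: msup_def tau_def split: if_splits)
qed

lemma phi_E_pair:
  assumes j: "j \<in> YY m n" and q: "q \<in> YY m n" "q \<noteq> j"
  shows "\<exists>c. (d = 1 \<longrightarrow> c = 0) \<and> phi (E j) (h {j, q}) = scaleW c (br (E j) (h {j, q}))"
proof -
  let ?z = "phi (E j) (h {j, q})" and ?q = "ip q"
  have jq: "{j, q} \<subseteq> YY m n" using j q by auto
  have q': "?q \<in> YY m n" using q ip_YY by blast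
  have z: "hh ((tau m j + par {j, q} + d) mod 2) ?z" by (intro hh_phi hh_E hh_h j jq)
  have "{j, q} - {j} = {q}" using q by auto
  then have b: "br (E j) (h {j, q}) = scaleW (eps j {j, q}) (h {q})" using j by (simp add: br_E_h)
  obtain e where e: "e \<noteq> 0" "br (E j) (h {j, q}) = scaleW e (E ?q)"
  proof -
    obtain e where "e \<noteq> 0" "h {q} = scaleW e (E ?q)" using h_single[OF q(1)] by blast
    then show thesis using eps_nz[of j "{j, q}"] b by (intro that[of "eps j {j, q} * e"]) simp_all
  qed
  \<comment> \<open>\<open>E l\<close> kills \<open>h {j, q}\<close> or lowers it to some
    \<open>h {r}\<close>, a multiple of a partial derivative, on which \<open>phi (E j)\<close>
    vanishes.\<close>
  have zc: "br (E l) ?z = 0" if l: "l \<in> YY m n" for l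
  proof -
    have phs: "phi (E j) (h {r}) = 0" if "r \<in> YY m n" for r
      using h_single[OF that] phi_E_E[OF j ip_YY[OF that]] by (auto simp: phi_scale_right E_in_H j ip_YY that)
    have "phi (E j) (br (E l) (h {j, q})) = 0"
    proof (cases "l \<in> {j, q}")
      case True
      then obtain r where r: "r \<in> YY m n" "{j, q} - {l} = {r}" using j q by auto
      then have "br (E l) (h {j, q}) = scaleW (eps l {j, q}) (h {r})" using True l by (simp add: br_E_h)
      then show ?thesis using phs[OF r(1)] r by (simp add: phi_scale_right E_in_H j h_in_H)
    next
      case False
      then show ?thesis using l by (simp add: br_E_h phi_0_right E_in_H j)
    qed
    then have "scaleW ((-1) ^ ((d + tau m j) * tau m l)) (br (E l) ?z) = 0"
      using phi_E_br[OF j l hh_h[OF jq]] by simp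
    then show ?thesis by (simp add: scaleW_eq_0)
  qed
  define a where "a k = ?z k (msup {})" for k
  have ze: "?z = (\<Sum>k\<in>YY m n. scaleW (a k) (E k))"
    unfolding a_def using constant_coeffs[OF hhD(2)[OF z] zc] .
  have a0: "a s = 0" if s: "s \<in> YY m n" "s \<noteq> ?q" for s
  proof -
    \<comment> \<open>The indices \<open>?q\<close>, \<open>s\<close>, \<open>i\<close>,
      \<open>r\<close> are distinct, which needs \<open>m + n \<ge> 4\<close>. The cubic monomial on
      \<open>i\<close>, \<open>s\<close>, \<open>r\<close> avoids \<open>?q\<close>, so
      \<open>phi (E i) ?y\<close> commutes with \<open>E ?q\<close>, the direction of the bracket of
      \<open>E j\<close> and \<open>h {j, q}\<close>. Then \<open>phi_br_commute\<close> makes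
      \<open>?z\<close> commute with \<open>h {s, r}\<close>, which reads off
      \<open>a s = 0\<close>.\<close>
    obtain i where i: "i \<in> YY m n" "i \<notin> {s, ?q}"
      using fresh_index[of "{s, ?q}"] card_insert_le_m1[of 2 "{?q}" s] by auto
    obtain r where r: "r \<in> YY m n" "r \<notin> {s, ?q, i}"
      using fresh_index[of "{s, ?q, i}"] card_insert_le_m1[of 2 "{i}" ?q] card_insert_le_m1[of 3 "{?q, i}" s] by auto
    let ?y = "h {i, s, r}"
    have sub: "{i, s, r} \<subseteq> YY m n" "{s, r} \<subseteq> YY m n" using i s r by auto
    have "br (E ?q) ?y = 0" using q' i s r by (simp add: br_E_h)
    then have "br (E ?q) (phi (E i) ?y) = 0"
    proof -
      assume "br (E ?q) ?y = 0"
      then have "scaleW ((-1) ^ ((d + tau m i) * tau m ?q)) (br (E ?q) (phi (E i) ?y)) = 0"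
        using phi_E_br[OF i(1) q' hh_h[OF sub(1)]] by (simp add: phi_0_right E_in_H i)
      then show ?thesis by (simp add: scaleW_eq_0)
    qed
    then have "br (phi (E i) ?y) (E ?q) = 0"
      by (rule br_zero_swap[OF hh_E[OF q'] hh_phi[OF hh_E[OF i(1)] hh_h[OF sub(1)]]])
    then have "br (phi (E i) ?y) (br (E j) (h {j, q})) = 0" unfolding e by (simp add: br_scale_right)
    then have 1: "scaleW ((-1) ^ (d * (tau m j + par {i, s, r}))) (br (br (E i) ?y) ?z) = 0"
      using phi_br_commute[OF hh_E[OF i(1)] hh_h[OF sub(1)] hh_E[OF j] hh_h[OF jq]] by simp
    have "{i, s, r} - {i} = {s, r}" using i r by auto
    then have "br (E i) ?y = scaleW (eps i {i, s, r}) (h {s, r})" using i by (simp add: br_E_h)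
    then have "scaleW ((-1) ^ (d * (tau m j + par {i, s, r})) * eps i {i, s, r}) (br (h {s, r}) ?z) = 0"
      using 1 by (simp add: br_scale_left)
    then have "br (h {s, r}) ?z = 0" using eps_nz by (simp add: scaleW_eq_0)
    then have "br ?z (h {s, r}) = 0" by (rule br_zero_swap[OF hh_h[OF sub(2)] z])
    then show ?thesis unfolding ze using E_combination_pair[of a s r] s r by auto
  qed
  have "?z = (\<Sum>k\<in>YY m n. if k = ?q then scaleW (a ?q) (E ?q) else 0)"
    by (subst ze, intro sum.cong refl) (simp add: a0)
  then have zq: "?z = scaleW (a ?q) (E ?q)" using q' finite_YY by simp
  \<comment> \<open>Otherwise \<open>?z\<close> and the bracket would be nonzero multiples of the
    same \<open>E ?q\<close>, although their parities differ by \<open>d\<close>.\<close>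
  have "a ?q = 0" if "d = 1"
  proof (rule ccontr)
    assume nz: "a ?q \<noteq> 0"
    have "(tau m j + par {j, q}) mod 2 = tau m ?q"
      using hhD(2)[OF hh_br[OF hh_E[OF j] hh_h[OF jq]]] unfolding e by (rule hw_scaled_E[OF _ e(1) q'])
    moreover have "(tau m j + par {j, q} + d) mod 2 = tau m ?q"
      using hhD(2)[OF z] unfolding zq by (rule hw_scaled_E[OF _ nz q'])
    ultimately show False using that by presburger
  qed
  moreover have "?z = scaleW (a ?q / e) (br (E j) (h {j, q}))" unfolding zq e(2) using e(1) by simp
  ultimately show ?thesis by (intro exI[of _ "a ?q / e"]) auto
qed

text \<open>\<open>E l\<close> is a nonzero multiple of the bracket of \<open>E j\<close> and
  \<open>h {j, ip l}\<close>, a pair on which \<open>phi\<close> is already scalar. So the deviation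
  of \<open>phi (E i) y\<close> from \<open>c\<close> times the bracket commutes with
  \<open>E l\<close>, and \<open>E l\<close> can be moved into the second argument. At this stage
  \<open>c\<close> still depends on \<open>l\<close>.\<close>

lemma phi_E_scalar:
  assumes l: "l \<in> YY m n"
  shows "\<exists>c. (d = 1 \<longrightarrow> c = 0) \<and>
    (\<forall>i\<in>YY m n. \<forall>b y. hh b y \<longrightarrow> phi (E i) (br (E l) y) = scaleW c (br (E i) (br (E l) y)))"
proof -
  define q where "q = ip l"
  have q: "q \<in> YY m n" "ip q = l" using l by (auto simp: q_def ip_YY ip_ip)
  obtain j where j: "j \<in> YY m n" "j \<notin> {q}" using fresh_index[of "{q}"] by auto
  have jq: "{j, q} \<subseteq> YY m n" using j q by auto
  obtain c where c: "d = 1 \<longrightarrow> c = 0" "phi (E j) (h {j, q}) = scaleW c (br (E j) (h {j, q}))"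
    using phi_E_pair[OF j(1) q(1)] j by auto
  have "{j, q} - {j} = {q}" using j by auto
  then have b: "br (E j) (h {j, q}) = scaleW (eps j {j, q}) (h {q})" using j by (simp add: br_E_h)
  obtain e where e: "e \<noteq> 0" "br (E j) (h {j, q}) = scaleW e (E l)"
  proof -
    obtain e where "e \<noteq> 0" "h {q} = scaleW e (E l)" using h_single[OF q(1)] q(2) by auto
    then show thesis using eps_nz[of j "{j, q}"] b by (intro that[of "eps j {j, q} * e"]) simp_all
  qed
  have "phi (E i) (br (E l) y) = scaleW c (br (E i) (br (E l) y))" if i: "i \<in> YY m n" and y: "hh b y" for i b y
  proof -
    let ?w = "phi (E i) y - scaleW c (br (E i) y)"
    have "br ?w (br (E j) (h {j, q})) = 0"
      using br_deviation[OF hh_E[OF i] y _ hh_E[OF j(1)] hh_h[OF jq] c(2)] c(1) by blast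
    then have "br ?w (E l) = 0" unfolding e(2) br_scale_right scaleW_eq_0 using e(1) by blast
    moreover have "hh ((tau m i + b + d) mod 2) ?w" using hh_deviation[OF hh_E[OF i] y] c(1) by blast
    ultimately have "br (E l) ?w = 0" using br_zero_swap hh_E[OF l] by blast
    then have "br (E l) (phi (E i) y) = scaleW c (br (E l) (br (E i) y))"
      using br_add_right[of "E l" "phi (E i) y" "scaleW (- c) (br (E i) y)"]
      by (simp add: br_minus br_scale_right)
    \<comment> \<open>The two signs differ by \<open>d * tau m l\<close>: nothing for
      \<open>d = 0\<close>, while \<open>c = 0\<close> for \<open>d = 1\<close>.\<close>
    then show ?thesis unfolding phi_E_br[OF i l y] br_E_br[OF i l y]
      using c(1) d_cases by (auto simp: mult.commute)
  qed
  then show ?thesis using c(1) by (intro exI[of _ c] conjI ballI allI impI) simp_all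
qed

lemma phi_scalar_E_h:
  "\<exists>c. (d = 1 \<longrightarrow> c = 0) \<and> (\<forall>i\<in>YY m n. \<forall>S. S \<subseteq> YY m n \<longrightarrow> card S \<le> 3 \<longrightarrow>
     phi (E i) (h S) = scaleW c (br (E i) (h S)))"
proof -
  obtain C where C0: "\<forall>l\<in>YY m n. (d = 1 \<longrightarrow> C l = 0) \<and>
    (\<forall>i\<in>YY m n. \<forall>b y. hh b y \<longrightarrow> phi (E i) (br (E l) y) = scaleW (C l) (br (E i) (br (E l) y)))"
    using bchoice[OF ballI[OF phi_E_scalar]] ..
  have C: "d = 1 \<Longrightarrow> C l = 0" "i \<in> YY m n \<Longrightarrow> hh b y \<Longrightarrow> phi (E i) (br (E l) y) = scaleW (C l) (br (E i) (br (E l) y))"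
    if "l \<in> YY m n" for l i b y
    using bspec[OF C0 that] by simp_all
  have P: "phi (E i) (h S) = scaleW (C l) (br (E i) (h S))"
    if "i \<in> YY m n" "l \<in> YY m n" "l \<notin> S" "S \<subseteq> YY m n" for i l S
  proof -
    have y: "hh (par (insert l S)) (h (insert l S))" using that by (intro hh_h) auto
    have "br (E l) (h (insert l S)) \<in> H" using y hh_E[OF that(2)] by (auto simp: hh_def H_br)
    then show ?thesis unfolding h_eq_br[OF that(2,3)]
      using C(2)[OF that(2,1) y] that(1) by (simp add: phi_scale_right E_in_H br_scale_right mult.commute)
  qed
  \<comment> \<open>Both scalars are compared on \<open>E i\<close> and \<open>h {i, s}\<close>,
    where \<open>i\<close> and \<open>s\<close> avoid \<open>l\<close> and \<open>r\<close>; the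
    bracket there is a nonzero multiple of \<open>h {s}\<close>.\<close>
  have eq: "C l = C r" if l: "l \<in> YY m n" and r: "r \<in> YY m n" for l r
  proof -
    obtain i where i: "i \<in> YY m n" "i \<notin> {l, r}"
      using fresh_index[of "{l, r}"] card_insert_le_m1[of 2 "{r}" l] by auto
    obtain s where s: "s \<in> YY m n" "s \<notin> {l, r, i}"
      using fresh_index[of "{l, r, i}"] card_insert_le_m1[of 2 "{i}" r] card_insert_le_m1[of 3 "{r, i}" l] by auto
    have "scaleW (C l) (br (E i) (h {i, s})) = scaleW (C r) (br (E i) (h {i, s}))"
      using P[OF i(1) l, of "{i, s}"] P[OF i(1) r, of "{i, s}"] i s by auto
    moreover have "{i, s} - {i} = {s}" using s by auto
    then have "br (E i) (h {i, s}) = scaleW (eps i {i, s}) (h {s})" using i by (simp add: br_E_h)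
    ultimately have "scaleW ((C l - C r) * eps i {i, s}) (h {s}) = 0"
      by (auto simp: fun_eq_iff algebra_simps)
    then have "(C l - C r) * eps i {i, s} = 0"
      using h_nz[of "{s}"] s by (simp add: scaleW_eq_0)
    then show ?thesis using eps_nz by simp
  qed
  have one: "1 \<in> YY m n" using m_ge by (simp add: YY_def)
  have "phi (E i) (h S) = scaleW (C 1) (br (E i) (h S))" if i: "i \<in> YY m n" and S: "S \<subseteq> YY m n" "card S \<le> 3" for i S
  proof -
    obtain l where "l \<in> YY m n" "l \<notin> S" using fresh_index[of S] finite_subset[OF S(1) finite_YY] S(2) by auto
    then show ?thesis using P[OF i _ _ S(1), of l] eq[OF one, of l] by simp
  qed
  then show ?thesis using C(1)[OF one] by (intro exI[of _ "C 1"] conjI ballI allI impI)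
qed

lemma phi_inner: "\<exists>c. \<forall>x\<in>H. \<forall>y\<in>H. phi x y = scaleW c (br x y)"
proof -
  obtain c where c: "d = 1 \<Longrightarrow> c = 0"
    "\<And>i S. i \<in> YY m n \<Longrightarrow> S \<subseteq> YY m n \<Longrightarrow> card S \<le> 3 \<Longrightarrow> phi (E i) (h S) = scaleW c (br (E i) (h S))"
    using phi_scalar_E_h by auto
  have hom: "phi x y = scaleW c (br x y)" if x: "hh a x" and y: "hh b y" for a b x y
  proof -
    have "phi x y - scaleW c (br x y) = 0"
    proof (rule centralizer_br_0)
      show "hh ((a + b + d) mod 2) (phi x y - scaleW c (br x y))" using hh_deviation[OF x y c(1)] .
      show "br (phi x y - scaleW c (br x y)) (br (E j) (h S)) = 0"
        if "j \<in> YY m n" "S \<subseteq> YY m n" "card S \<le> 3" for j S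
        using br_deviation[OF x y c(1) hh_E[OF that(1)] hh_h[OF that(2)] c(2)[OF that]] by blast
    qed
    then show ?thesis by simp
  qed
  have "phi x y = scaleW c (br x y)" if x: "x \<in> H" and y: "y \<in> H" for x y
  proof -
    obtain x0 x1 where x: "hh 0 x0" "hh 1 x1" "x = x0 + x1" using H_split[OF x] unfolding hh_def by blast
    obtain y0 y1 where y: "hh 0 y0" "hh 1 y1" "y = y0 + y1" using H_split[OF y] unfolding hh_def by blast
    note mem = x(1,2)[THEN hhD(1)] y(1,2)[THEN hhD(1)]
    have "phi x y = phi x0 y0 + phi x0 y1 + (phi x1 y0 + phi x1 y1)"
      unfolding x(3) y(3) using mem H_add by (simp add: phi_add_left phi_add_right)
    also have "\<dots> = scaleW c (br x0 y0 + br x0 y1 + (br x1 y0 + br x1 y1))"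
      using hom x(1,2) y(1,2) by simp
    finally show ?thesis unfolding x(3) y(3) by (simp add: br_add_left br_add_right add_ac)
  qed
  then show ?thesis by blast
qed

end

theorem mainTheorem1:
  fixes p m n :: nat and tt :: "nat \<Rightarrow> nat" and dphi :: nat
    and phi :: "'a::alg_closed_field wel \<Rightarrow> 'a wel \<Rightarrow> 'a wel"
  assumes "prime p" and "CHAR('a) = p" and "p > 2"
    and "even m" and "even n" and "m \<ge> 2" and "n \<ge> 2"
    and "\<forall>i\<in>{1..m}. tt i > 0"
    and "skew_super_biderivation (Hset p m n tt) (brW p m n tt) (homW m) dphi phi"
  shows "\<exists>c::'a. \<forall>x\<in>Hset p m n tt. \<forall>y\<in>Hset p m n tt. phi x y = scaleW c (brW p m n tt x y)"
proof -
  interpret hamiltonian_biderivation p m n tt "TYPE('a)" dphi phi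
    using assms by unfold_locales auto
  show ?thesis by (rule phi_inner)
qed

end
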